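(* Fix an integer $m\ge 1$, reals $a\in\left(0,\frac{m}{m+2}\right)$, $0<\delta<\frac14\left(1-\frac{a(m+2)}{m}\right)$ and $0<b<\frac12\left(1-\frac{a(m+2)}{m}\right)$, and put $j_n=\lfloor n^a\rfloor$. Let $D(j)$ be the degree of vertex $j$ in the random multigraph $G_m^n$ generated from the sums of exponentials $\mathbf W=\{W_k\}$ as described in the context, and let $$\mathcal D(j)=2(mn)^{1/2}\bigl(W_{mj}^{1/2}-W_{m(j-1)}^{1/2}\bigr).$$ (1) For every $$\Delta<\min\left(\frac{1-a}{2}-\delta;\ \frac m2\Bigl(1-\frac{a(m+2)}{m}\Bigr)-2m\delta\right)$$ one has, for all sufficiently large $n$, $$\mathbb P\Bigl(D(j)=\bigl(1+O(n^{-\delta})\bigr)\mathcal D(j)\ \text{ for all } j\le j_n\Bigr)\ge 1-n^{-\Delta},$$ meaning: there is a constant $C$ (independent of $n$ and $j$) such that for all large $n$, with probability at least $1-n^{-\Delta}$, $|D(j)-\mathcal D(j)|\le Cn^{-\delta}\mathcal D(j)$ for all $1\le j\le j_n$. (2) Consequently, for every such $\Delta$ and every $$\Delta_1<\min\left(\Delta;\ m\left[\tfrac12\Bigl(1-\tfrac{a(m+2)}{m}\Bigr)-b\right]\right),$$ one has, for all sufficiently large $n$, $\mathbb P\bigl(\min_{j\le j_n}D(j)>n^b\bigr)\ge 1-n^{-\Delta_1}$. Thus, for $\varepsilon\in(0,\frac{m}{m+2})$, with probability tending to $1$ as $n\to\infty$ the first $n^{\frac{m}{m+2}-\varepsilon}$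 vertex degrees are each at least $n^{\frac{\varepsilon(m+2)}{2m}}$.
   Context: Construction of the Bollobás–Riordan preferential attachment multigraph $G_m^n$ (fixed $m\ge1$, $n\to\infty$). Let $w_1,\dots,w_{mn+1}$ be independent exponential random variables with mean $1$, $W_k=\sum_{i=1}^k w_i$, $W_0=0$, $\mathbf W=\{W_k\}$. Put $R_k=W_k/W_{mn+1}$ for $k=1,\dots,mn$, $R_0=0$. Conditionally on $\mathbf W$, let $\ell_1,\dots,\ell_{mn}$ be independent, $\ell_k$ having density $\frac{1}{2\sqrt{R_k x}}$ on $(0,R_k]$. The vertex set of $G_m^n$ is $[n]=\{1,\dots,n\}$; vertex $j$ is identified with the interval $(R_{m(j-1)},R_{mj}]$, so it contains the $m$ right endpoints $R_{m(j-1)+1},\dots,R_{mj}$. For each $k\in[mn]$ there is one edge joining the vertex containing $R_k$ with the vertex containing $\ell_k$ (a loop if these coincide). A loop contributes $2$ to the degree of its vertex.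
   Formalization: In the last sentence of (2) the degree bound is proved with exponent ε(m+2)/(2m) − η for every η > 0; with the printed exponent the probability tends to exp(−1/(m!(m/2+1))) < 1, so the sentence fails as printed. *)

theory Defs
  imports "HOL-Probability.Probability" "HOL-Library.Multiset"
begin

definition partial_sum :: "(nat \<Rightarrow> real) \<Rightarrow> nat \<Rightarrow> real" where
  "partial_sum w k = (\<Sum>i=1..k. w i)"

definition right_end :: "nat \<Rightarrow> nat \<Rightarrow> (nat \<Rightarrow> real) \<Rightarrow> nat \<Rightarrow> real" where
  "right_end m n w k = partial_sum w k / partial_sum w (m * n + 1)"

definition left_density :: "real \<Rightarrow> real \<Rightarrow> real" where
  "left_density r x = (if 0 < x \<and> x \<le> r then 1 / (2 * sqrt (r * x)) else 0)"

definition exp_law :: "nat \<Rightarrow> nat \<Rightarrow> (nat \<Rightarrow> real) measure" where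
  "exp_law m n = PiM {1..m * n + 1} (\<lambda>i. density lborel (\<lambda>x. ennreal (exponential_density 1 x)))"

text \<open>The conditional law of the left ends given the exponential variables. Outside the null set
  of those \<open>w\<close> for which some \<open>right_end m n w k\<close> fails to be positive, this is a probability
  measure; on that null set it is the zero measure.\<close>

definition left_law :: "nat \<Rightarrow> nat \<Rightarrow> (nat \<Rightarrow> real) \<Rightarrow> (nat \<Rightarrow> real) measure" where
  "left_law m n w =
     PiM {1..m * n} (\<lambda>k. density lborel (\<lambda>x. ennreal (left_density (right_end m n w k) x)))"

definition attach_law :: "nat \<Rightarrow> nat \<Rightarrow> ((nat \<Rightarrow> real) \<times> (nat \<Rightarrow> real)) measure" where
  "attach_law m n =
     exp_law m n \<bind> (\<lambda>w. left_law m n w \<bind> (\<lambda>l.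
       return (PiM {1..m * n + 1} (\<lambda>_. borel) \<Otimes>\<^sub>M PiM {1..m * n} (\<lambda>_. borel)) (w, l)))"

text \<open>The vertex whose interval contains \<open>x\<close>. For positive \<open>w\<close> the intervals are disjoint and
  cover \<open>(0, R\<^sub>m\<^sub>n]\<close>, so that \<open>LEAST\<close> picks the only candidate.\<close>

definition vertex_of :: "nat \<Rightarrow> nat \<Rightarrow> (nat \<Rightarrow> real) \<Rightarrow> real \<Rightarrow> nat" where
  "vertex_of m n w x =
     (LEAST j. j \<in> {1..n} \<and> x \<in> {right_end m n w (m * (j - 1)) <.. right_end m n w (m * j)})"

text \<open>A multigraph is given by the multiset of its edges, each edge being listed as a pair of end
  vertices in either order.\<close>

definition attach_graph ::
  "nat \<Rightarrow> nat \<Rightarrow> (nat \<Rightarrow> real) \<times> (nat \<Rightarrow> real) \<Rightarrow> (nat \<times> nat) multiset" where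
  "attach_graph m n = (\<lambda>(w, l).
     image_mset (\<lambda>k. (vertex_of m n w (right_end m n w k), vertex_of m n w (l k)))
       (mset_set {1..m * n}))"

definition mdegree :: "('v \<times> 'v) multiset \<Rightarrow> 'v \<Rightarrow> nat" where
  "mdegree G v = (\<Sum>(x, y)\<in>#G. of_bool (x = v) + of_bool (y = v))"

definition attach_degree ::
  "nat \<Rightarrow> nat \<Rightarrow> (nat \<Rightarrow> real) \<times> (nat \<Rightarrow> real) \<Rightarrow> nat \<Rightarrow> nat" where
  "attach_degree m n \<omega> j = mdegree (attach_graph m n \<omega>) j"

definition approx_degree ::
  "nat \<Rightarrow> nat \<Rightarrow> (nat \<Rightarrow> real) \<times> (nat \<Rightarrow> real) \<Rightarrow> nat \<Rightarrow> real" where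
  "approx_degree m n \<omega> j =
     2 * sqrt (real (m * n)) *
       (sqrt (partial_sum (fst \<omega>) (m * j)) - sqrt (partial_sum (fst \<omega>) (m * (j - 1))))"


lemma nn_integral_left_density:
  "(\<integral>\<^sup>+x. ennreal (left_density r x) \<partial>lborel) = (if 0 < r then 1 else 0)"
proof (cases "0 < r")
  case True
  have 1: "((\<lambda>x. 1 / (2 * sqrt (r * x))) has_integral (sqrt (r / r) - sqrt (0 / r))) {0..r}"
  proof (rule fundamental_theorem_of_calculus_interior)
    show "continuous_on {0..r} (\<lambda>x. sqrt (x / r))"
      using True by (intro continuous_intros) auto
    fix x assume x: "x \<in> {0<..<r}"
    have e: "inverse (sqrt (x / r)) / 2 * (1 / r) = 1 / (2 * sqrt (r * x))"
    proof -
      have "sqrt r * sqrt r = r" using True by simp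
      then show ?thesis using x True
        by (simp add: real_sqrt_mult real_sqrt_divide field_simps)
    qed
    have "((\<lambda>x. sqrt (x / r)) has_real_derivative (inverse (sqrt (x / r)) / 2 * (1 / r))) (at x)"
      using x True by (auto intro!: derivative_eq_intros simp: divide_simps)
    then show "((\<lambda>x. sqrt (x / r)) has_vector_derivative 1 / (2 * sqrt (r * x))) (at x)"
      unfolding e has_real_derivative_iff_has_vector_derivative .
  qed (use True in auto)
  have 2: "((\<lambda>x. if x \<in> {0..r} then 1 / (2 * sqrt (r * x)) else 0) has_integral 1) UNIV"
    using 1 True by (subst has_integral_restrict_UNIV) simp
  have "(left_density r has_integral 1) UNIV"
    by (rule has_integral_spike[OF _ _ 2, of "{0}"]) (auto simp: left_density_def)
  then have "(\<integral>\<^sup>+x. ennreal (left_density r x) \<partial>lborel) = ennreal 1"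
    by (intro nn_integral_has_integral_lborel) (auto simp: left_density_def[abs_def])
  with True show ?thesis by simp
next
  case False
  then have "left_density r = (\<lambda>_. 0)" by (auto simp: left_density_def)
  with False show ?thesis by simp
qed

lemma partial_sum_measurable [measurable]:
  "k \<le> N \<Longrightarrow> (\<lambda>w. partial_sum w k) \<in> borel_measurable (PiM {1..N} (\<lambda>_. borel))"
  unfolding partial_sum_def by (intro borel_measurable_sum measurable_component_singleton) auto

lemma right_end_measurable:
  "k \<le> m * n \<Longrightarrow>
    (\<lambda>w. right_end m n w k) \<in> borel_measurable (PiM {1..m * n + 1} (\<lambda>_. borel))"
  unfolding right_end_def by measurable auto

lemma left_density_measurable [measurable]:
  "(\<lambda>(r, x). left_density r x) \<in> borel_measurable (borel \<Otimes>\<^sub>M borel)"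
  unfolding left_density_def by measurable

lemma sets_exp_law [measurable_cong]:
  "sets (exp_law m n) = sets (PiM {1..m * n + 1} (\<lambda>_. borel))"
  unfolding exp_law_def by (intro sets_PiM_cong) auto

lemma sets_left_law [measurable_cong]:
  "sets (left_law m n w) = sets (PiM {1..m * n} (\<lambda>_. borel))"
  unfolding left_law_def by (intro sets_PiM_cong) auto

lemma prob_space_exp_law: "prob_space (exp_law m n)"
  unfolding exp_law_def by (intro prob_space_PiM prob_space_exponential_density) simp

lemma emeasure_left_law_PiE:
  assumes "\<And>k. k \<in> {1..m * n} \<Longrightarrow> A k \<in> sets borel"
  shows "emeasure (left_law m n w) (PiE {1..m * n} A) =
    (\<Prod>k\<in>{1..m * n}. \<integral>\<^sup>+x. ennreal (left_density (right_end m n w k) x) * indicator (A k) x \<partial>lborel)"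
proof -
  have fin: "finite_measure (density lborel (\<lambda>x. ennreal (left_density r x)))" for r
    by (rule finite_measureI) (simp add: emeasure_density nn_integral_left_density)
  interpret product_sigma_finite
    "\<lambda>k. density lborel (\<lambda>x. ennreal (left_density (right_end m n w k) x))"
    unfolding product_sigma_finite_def by (auto intro: fin finite_measure.axioms)
  show ?thesis
    unfolding left_law_def using assms
    by (subst emeasure_PiM) (auto intro!: prod.cong simp: emeasure_density)
qed

lemma emeasure_left_law_space:
  "emeasure (left_law m n w) (space (left_law m n w)) =
    (if \<forall>k\<in>{1..m * n}. 0 < right_end m n w k then 1 else 0)"
proof -
  have "space (left_law m n w) = PiE {1..m * n} (\<lambda>_. UNIV)"
    by (simp add: left_law_def space_PiM)
  then show ?thesis
    by (auto simp add: emeasure_left_law_PiE nn_integral_left_density simp del: One_nat_def)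
qed

lemma left_law_measurable [measurable]:
  "left_law m n \<in> measurable (PiM {1..m * n + 1} (\<lambda>_. borel))
     (subprob_algebra (PiM {1..m * n} (\<lambda>_. borel)))"
proof (rule measurable_subprob_algebra_generated[OF sets_PiM Int_stable_prod_algebra
      prod_algebra_sets_into_space])
  have m: "(\<lambda>w. emeasure (left_law m n w) (PiE {1..m * n} A))
      \<in> borel_measurable (PiM {1..m * n + 1} (\<lambda>_. borel))"
    if "\<And>k. k \<in> {1..m * n} \<Longrightarrow> A k \<in> sets borel" for A
  proof (subst emeasure_left_law_PiE[OF that], assumption, intro borel_measurable_prod_ennreal)
    fix k assume k: "k \<in> {1..m * n}"
    have [measurable]: "(\<lambda>w. right_end m n w k) \<in> borel_measurable (PiM {1..m * n + 1} (\<lambda>_. borel))"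
      using k by (intro right_end_measurable) auto
    have [measurable]: "A k \<in> sets borel" using that k .
    show "(\<lambda>w. \<integral>\<^sup>+x. ennreal (left_density (right_end m n w k) x) * indicator (A k) x \<partial>lborel)
        \<in> borel_measurable (PiM {1..m * n + 1} (\<lambda>_. borel))"
      by measurable
  qed
  show "subprob_space (left_law m n a)" for a
    by (rule subprob_spaceI)
      (simp_all add: emeasure_left_law_space, simp add: left_law_def space_PiM PiE_eq_empty_iff)
  show "sets (left_law m n a) = sets (PiM {1..m * n} (\<lambda>_. borel))" for a
    by (rule sets_left_law)
  show "(\<lambda>a. emeasure (left_law m n a) A) \<in> borel_measurable (PiM {1..m * n + 1} (\<lambda>_. borel))"
    if A: "A \<in> prod_algebra {1..m * n} (\<lambda>_. borel)" for A
  proof -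
    obtain X where "A = PiE {1..m * n} X" "X \<in> (\<Pi> k\<in>{1..m * n}. sets borel)"
      using A by (auto simp: prod_algebra_eq_finite)
    then show ?thesis using m[of X] by blast
  qed
  show "(\<lambda>a. emeasure (left_law m n a) (\<Pi>\<^sub>E i\<in>{1..m * n}. space borel))
      \<in> borel_measurable (PiM {1..m * n + 1} (\<lambda>_. borel))"
    by (rule m) auto
qed

lemma AE_exp_law_pos: "AE w in exp_law m n. \<forall>i\<in>{1..m * n + 1}. 0 < w i"
proof -
  have "AE w in exp_law m n. 0 < w i" if "i \<in> {1..m * n + 1}" for i
    unfolding exp_law_def
  proof (rule AE_PiM_component[OF _ that])
    show "prob_space (density lborel (\<lambda>x. ennreal (exponential_density 1 x)))" for i :: nat
      by (rule prob_space_exponential_density) simp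
    have "AE x in lborel. x \<noteq> (0::real)" by (rule AE_lborel_singleton)
    then show "AE x in density lborel (\<lambda>x. ennreal (exponential_density 1 x)). 0 < x"
      by (subst AE_density) (auto simp: exponential_density_def elim!: eventually_mono split: if_splits)
  qed
  then show ?thesis by (simp add: AE_finite_all)
qed

lemma prob_space_attach_law: "prob_space (attach_law m n)"
proof -
  let ?W = "PiM {1..m * n + 1} (\<lambda>_. borel) :: (nat \<Rightarrow> real) measure"
  let ?L = "PiM {1..m * n} (\<lambda>_. borel) :: (nat \<Rightarrow> real) measure"
  interpret E: prob_space "exp_law m n" by (rule prob_space_exp_law)
  have sp: "space (exp_law m n) = space ?W" by (rule sets_eq_imp_space_eq[OF sets_exp_law])
  have K: "(\<lambda>w. left_law m n w \<bind> (\<lambda>l. return (?W \<Otimes>\<^sub>M ?L) (w, l)))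
      \<in> measurable (exp_law m n) (subprob_algebra (?W \<Otimes>\<^sub>M ?L))"
    by measurable
  show ?thesis
    unfolding attach_law_def
  proof (rule E.prob_space_bind[OF _ K])
    show "AE w in exp_law m n. prob_space (left_law m n w \<bind> (\<lambda>l. return (?W \<Otimes>\<^sub>M ?L) (w, l)))"
      using AE_exp_law_pos AE_space
    proof eventually_elim
      case (elim w)
      have pos: "0 < partial_sum w k" if "k \<in> {1..m * n + 1}" for k
        unfolding partial_sum_def using elim(1) that by (intro sum_pos) auto
      have "\<forall>k\<in>{1..m * n}. 0 < right_end m n w k"
        unfolding right_end_def using pos by auto
      then have "prob_space (left_law m n w)"
        by (intro prob_spaceI) (simp add: emeasure_left_law_space)
      moreover have "w \<in> space ?W" using elim(2) sp by simp
      then have "(\<lambda>l. (w, l)) \<in> measurable (left_law m n w) (?W \<Otimes>\<^sub>M ?L)" by measurable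
      ultimately show ?case
        by (subst bind_return_distr')
          (auto intro: prob_space.prob_space_distr dest: prob_space.not_empty)
    qed
  qed
qed

lemma sets_attach_law [measurable_cong]:
  "sets (attach_law m n) =
     sets (PiM {1..m * n + 1} (\<lambda>_. borel) \<Otimes>\<^sub>M PiM {1..m * n} (\<lambda>_. borel))"
proof -
  have ne: "space (left_law m n w) \<noteq> {}" for w
    by (simp add: left_law_def space_PiM PiE_eq_empty_iff)
  have "space (exp_law m n) \<noteq> {}"
    by (rule prob_space.not_empty[OF prob_space_exp_law])
  then show ?thesis
    unfolding attach_law_def by (intro sets_bind[OF sets_bind[OF sets_return ne]])
qed

lemma attach_degree_eq:
  "attach_degree m n \<omega> j =
    (\<Sum>k=1..m * n. of_bool (vertex_of m n (fst \<omega>) (right_end m n (fst \<omega>) k) = j)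
      + of_bool (vertex_of m n (fst \<omega>) (snd \<omega> k) = j))"
  unfolding attach_degree_def mdegree_def attach_graph_def sum_unfold_sum_mset
  by (simp only: case_prod_beta image_mset.compositionality comp_def fst_conv snd_conv)

lemma attach_degree_measurable:
  "(\<lambda>\<omega>. attach_degree m n \<omega> j) \<in> measurable (attach_law m n) (count_space UNIV)"
proof -
  let ?M = "PiM {1..m * n + 1} (\<lambda>_. borel) \<Otimes>\<^sub>M PiM {1..m * n} (\<lambda>_. borel)
    :: ((nat \<Rightarrow> real) \<times> (nat \<Rightarrow> real)) measure"
  have R: "(\<lambda>\<omega>. right_end m n (fst \<omega>) k) \<in> borel_measurable ?M" if "k \<le> m * n" for k
    by (rule measurable_compose[OF measurable_fst right_end_measurable[OF that]])
  have V: "(\<lambda>\<omega>. vertex_of m n (fst \<omega>) (X \<omega>)) \<in> measurable ?M (count_space UNIV)"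
    if X: "X \<in> borel_measurable ?M" for X
    unfolding vertex_of_def
  proof (rule measurable_Least)
    fix i :: nat
    show "Measurable.pred ?M (\<lambda>\<omega>. i \<in> {1..n} \<and>
        X \<omega> \<in> {right_end m n (fst \<omega>) (m * (i - 1)) <.. right_end m n (fst \<omega>) (m * i)})"
    proof (cases "i \<in> {1..n}")
      case True
      then have i: "m * i \<le> m * n" "m * (i - 1) \<le> m * n" by (auto intro: mult_le_mono)
      have "{\<omega> \<in> space ?M. right_end m n (fst \<omega>) (m * (i - 1)) < X \<omega>}
          \<inter> {\<omega> \<in> space ?M. X \<omega> \<le> right_end m n (fst \<omega>) (m * i)} \<in> sets ?M"
        by (rule sets.Int[OF borel_measurable_less[OF R[OF i(2)] X] borel_measurable_le[OF X R[OF i(1)]]])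
      also have "{\<omega> \<in> space ?M. right_end m n (fst \<omega>) (m * (i - 1)) < X \<omega>}
          \<inter> {\<omega> \<in> space ?M. X \<omega> \<le> right_end m n (fst \<omega>) (m * i)} =
        {\<omega> \<in> space ?M. i \<in> {1..n} \<and>
          X \<omega> \<in> {right_end m n (fst \<omega>) (m * (i - 1)) <.. right_end m n (fst \<omega>) (m * i)}}"
        using True by (simp only: greaterThanAtMost_iff) blast
      finally show ?thesis by (simp only: pred_def)
    next
      case False
      then show ?thesis by (simp only: simp_thms measurable_const space_count_space UNIV_I)
    qed
  qed
  have L: "(\<lambda>\<omega>. snd \<omega> k) \<in> borel_measurable ?M" if "k \<in> {1..m * n}" for k
    by (rule measurable_compose[OF measurable_snd measurable_component_singleton[OF that]])
  have "(\<lambda>\<omega>. \<Sum>k=1..m * n. of_bool (vertex_of m n (fst \<omega>) (right_end m n (fst \<omega>) k) = j)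
      + of_bool (vertex_of m n (fst \<omega>) (snd \<omega> k) = j) :: nat) \<in> measurable ?M (count_space UNIV)"
  proof (rule measurable_sum_nat)
    fix k assume k: "k \<in> {1..m * n}"
    then have "k \<le> m * n" by simp
    note [measurable] = V[OF R[OF this]] V[OF L[OF k]]
    show "(\<lambda>\<omega>. of_bool (vertex_of m n (fst \<omega>) (right_end m n (fst \<omega>) k) = j)
      + of_bool (vertex_of m n (fst \<omega>) (snd \<omega> k) = j) :: nat) \<in> measurable ?M (count_space UNIV)"
      by measurable
  qed
  then show ?thesis
    unfolding attach_degree_eq measurable_cong_sets[OF sets_attach_law refl] .
qed

end

theory Submission
  imports Defs "HOL-Real_Asymp.Real_Asymp"
begin

text \<open>
  Given the exponential variables, \<open>D(j) - m\<close> is a sum of independent indicators. With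
  \<open>s\<^sub>j = sqrt W\<^sub>m\<^sub>j - sqrt W\<^sub>m\<^sub>(\<^sub>j\<^sub>-\<^sub>1\<^sub>)\<close> its conditional mean is \<open>s\<^sub>j\<close> times the sum of
  \<open>1 / sqrt W\<^sub>k\<close> over \<open>m j < k \<le> m n\<close>, up to an error \<open>m\<close>. Replacing \<open>W\<^sub>k\<close> by \<open>k\<close> costs
  \<open>E \<bar>1 / sqrt W\<^sub>k - 1 / sqrt k\<bar> = O(1 / k)\<close>, so by Markov's inequality the sum is
  \<open>2 sqrt (m n) (1 + O(n powr (- \<delta>)))\<close>, uniformly in \<open>j\<close>, outside an event of probability
  \<open>O(n powr (\<delta> - 1 / 2) ln n)\<close>. A multiplicative Chernoff bound then gives relative error
  \<open>n powr (- \<delta>)\<close> with superpolynomially small failure probability, provided that all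
  \<open>2 sqrt (m n) s\<^sub>j\<close> are of order at least \<open>n powr (2 \<delta> + \<epsilon>)\<close>. This holds unless \<open>W\<close> at \<open>m n\<^sup>a\<close> exceeds
  four times its mean or some block sum \<open>W\<^sub>m\<^sub>j - W\<^sub>m\<^sub>(\<^sub>j\<^sub>-\<^sub>1\<^sub>)\<close> is too small; a block sum is at most
  \<open>y\<close> with probability at most \<open>y\<^sup>m\<close>, and a union bound over \<open>n\<^sup>a\<close> blocks produces the exponent
  \<open>m / 2 * (1 - a (m + 2) / m) - 2 m \<delta>\<close>. The same small-ball estimate with threshold
  \<open>n powr (b + \<epsilon>)\<close> yields the bound for the minimum degree.
\<close>


subsection \<open>A Chernoff bound for product measures\<close>

text \<open>For negative \<open>t\<close> put \<open>s = - t\<close>. Since \<open>exp s\<close>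
  dominates its quadratic Taylor polynomial, \<open>exp (- s)\<close> is at most the reciprocal of
  that polynomial, and the product computed below shows that \<open>1 - s + s\<^sup>2\<close>
  dominates the reciprocal.\<close>

lemma exp_le_quadratic:
  fixes t :: real
  assumes "\<bar>t\<bar> \<le> 1"
  shows "exp t \<le> 1 + t + t\<^sup>2"
proof (cases "0 \<le> t")
  case True
  then show ?thesis using exp_bound[of t] assms by simp
next
  case False
  define s where "s = - t"
  have s: "0 \<le> s" "s \<le> 1" using False assms by (auto simp: s_def)
  have pos: "0 < 1 + s + s\<^sup>2 / 2" using s by (intro add_pos_nonneg) auto
  have "(1 + s + s\<^sup>2 / 2) * exp (- s) \<le> exp s * exp (- s)"
    by (intro mult_right_mono exp_lower_Taylor_quadratic s) simp
  also have "\<dots> = 1" by (simp add: exp_minus)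
  also have "1 \<le> (1 + s + s\<^sup>2 / 2) * (1 - s + s\<^sup>2)"
  proof -
    have "(1 + s + s\<^sup>2 / 2) * (1 - s + s\<^sup>2) = 1 + s\<^sup>2 / 2 + s ^ 3 / 2 + s ^ 4 / 2"
      by (simp add: field_simps power2_eq_square power3_eq_cube power4_eq_xxxx)
    then show ?thesis using s by simp
  qed
  finally have "exp (- s) \<le> 1 - s + s\<^sup>2"
    using pos by (rule mult_left_le_imp_le)
  then show ?thesis by (simp add: s_def)
qed

text \<open>The exponential moment factors over the product, and each factor is at most
  \<open>exp (p * (t + t\<^sup>2))\<close> for the success probability \<open>p\<close>; Markov's
  inequality finishes. Both signs of \<open>t\<close> are allowed so that one statement covers both
  tails. Probability is demanded only on \<open>I\<close>: in the application the factor with index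
  \<open>0\<close> is the zero measure.\<close>

lemma prob_sum_indicator_exponential_bound:
  fixes M :: "'i \<Rightarrow> 'a measure" and A :: "'i \<Rightarrow> 'a set" and t c :: real
  assumes sf: "product_sigma_finite M" and fin: "finite I"
    and prob: "\<And>i. i \<in> I \<Longrightarrow> prob_space (M i)"
    and A: "\<And>i. i \<in> I \<Longrightarrow> A i \<in> sets (M i)"
    and t: "\<bar>t\<bar> \<le> 1"
  defines "\<mu> \<equiv> \<Sum>i\<in>I. measure (M i) (A i)"
  shows "measure (PiM I M)
    {x \<in> space (PiM I M). c + (t + t\<^sup>2) * \<mu> \<le> t * (\<Sum>i\<in>I. indicator (A i) (x i))} \<le> exp (- c)"
proof -
  interpret product_sigma_finite M by (rule sf)
  interpret P: prob_space "PiM I M" by (rule prob_space_PiM) (rule prob)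
  define f :: "'i \<Rightarrow> 'a \<Rightarrow> real" where "f i x = exp (t * indicator (A i) x)" for i x
  have f: "integrable (M i) (f i)" "integral\<^sup>L (M i) (f i) = 1 + measure (M i) (A i) * (exp t - 1)"
    if i: "i \<in> I" for i
  proof -
    interpret Mi: prob_space "M i" by (rule prob[OF i])
    have e: "f i = (\<lambda>x. 1 + (exp t - 1) * indicator (A i) x)"
      by (auto simp: f_def fun_eq_iff indicator_def)
    have ii: "integrable (M i) (\<lambda>x. (exp t - 1) * indicator (A i) x)"
      using A[OF i] by (simp add: Mi.emeasure_eq_measure)
    show "integrable (M i) (f i)" 
      unfolding e using ii by (intro Bochner_Integration.integrable_add) auto
    show "integral\<^sup>L (M i) (f i) = 1 + measure (M i) (A i) * (exp t - 1)"
      unfolding e using A[OF i] ii by (subst Bochner_Integration.integral_add) (auto simp: Mi.prob_space)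
  qed
  define F where "F x = (\<Prod>i\<in>I. f i (x i))" for x
  have F_eq: "F x = exp (t * (\<Sum>i\<in>I. indicator (A i) (x i)))" for x
    unfolding F_def f_def by (simp only: exp_sum[OF fin] sum_distrib_left)
  have Fi: "integrable (PiM I M) F"
    unfolding F_def using fin f(1) by (rule product_integrable_prod)
  have "integral\<^sup>L (PiM I M) F = (\<Prod>i\<in>I. integral\<^sup>L (M i) (f i))"
    unfolding F_def using fin f(1) by (rule product_integral_prod)
  also have "\<dots> = (\<Prod>i\<in>I. 1 + measure (M i) (A i) * (exp t - 1))"
    using f(2) by (rule prod.cong[OF refl])
  also have "\<dots> \<le> (\<Prod>i\<in>I. exp (measure (M i) (A i) * (t + t\<^sup>2)))"
  proof (intro prod_mono conjI)
    fix i assume i: "i \<in> I"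
    interpret Mi: prob_space "M i" by (rule prob[OF i])
    let ?p = "measure (M i) (A i)"
    have p: "0 \<le> ?p" "?p \<le> 1" by auto
    have "0 \<le> (1 - ?p) + ?p * exp t" using p by (intro add_nonneg_nonneg mult_nonneg_nonneg) auto
    then show "0 \<le> 1 + ?p * (exp t - 1)" by (simp add: algebra_simps)
    have "1 + ?p * (exp t - 1) \<le> 1 + ?p * (t + t\<^sup>2)"
      using exp_le_quadratic[OF t] p by (intro add_left_mono mult_left_mono) auto
    also have "\<dots> \<le> exp (?p * (t + t\<^sup>2))" by (rule exp_ge_add_one_self)
    finally show "1 + ?p * (exp t - 1) \<le> exp (?p * (t + t\<^sup>2))" .
  qed
  also have "\<dots> = exp ((t + t\<^sup>2) * \<mu>)"
    by (simp only: \<mu>_def exp_sum[OF fin, symmetric] sum_distrib_right[symmetric] mult.commute)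
  finally have EF: "integral\<^sup>L (PiM I M) F \<le> exp ((t + t\<^sup>2) * \<mu>)" .
  have "measure (PiM I M) {x \<in> space (PiM I M). exp (c + (t + t\<^sup>2) * \<mu>) \<le> F x}
      \<le> integral\<^sup>L (PiM I M) F / exp (c + (t + t\<^sup>2) * \<mu>)"
    by (rule integral_Markov_inequality_measure[OF Fi sets.top]) (simp_all add: F_eq)
  also have "\<dots> \<le> exp ((t + t\<^sup>2) * \<mu>) / exp (c + (t + t\<^sup>2) * \<mu>)"
    using EF by (rule divide_right_mono) simp
  also have "\<dots> = exp (- c)" by (simp add: exp_diff[symmetric])
  finally show ?thesis by (simp only: F_eq exp_le_cancel_iff)
qed

text \<open>The exponential bound at \<open>t = \<tau>\<close> and \<open>t = - \<tau>\<close>,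
  divided by \<open>\<tau>\<close>. The deviation is a relative part \<open>\<tau> * \<mu>\<close>
  plus an additive part \<open>c / \<tau>\<close>, which is of the same order once
  \<open>\<mu>\<close> is at least of order \<open>c / \<tau>\<^sup>2\<close>.\<close>

lemma prob_sum_indicator_deviation:
  fixes M :: "'i \<Rightarrow> 'a measure" and A :: "'i \<Rightarrow> 'a set" and \<tau> c :: real
  assumes sf: "product_sigma_finite M" and fin: "finite I"
    and prob: "\<And>i. i \<in> I \<Longrightarrow> prob_space (M i)"
    and A: "\<And>i. i \<in> I \<Longrightarrow> A i \<in> sets (M i)"
    and \<tau>: "0 < \<tau>" "\<tau> \<le> 1"
  defines "\<mu> \<equiv> \<Sum>i\<in>I. measure (M i) (A i)"
  shows "measure (PiM I M) {x \<in> space (PiM I M).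
    \<tau> * \<mu> + c / \<tau> \<le> \<bar>(\<Sum>i\<in>I. indicator (A i) (x i)) - \<mu>\<bar>} \<le> 2 * exp (- c)" (is "measure ?P ?E \<le> _")
proof -
  interpret P: prob_space "PiM I M" by (rule prob_space_PiM) (rule prob)
  define S :: "('i \<Rightarrow> 'a) \<Rightarrow> real" where "S x = (\<Sum>i\<in>I. indicator (A i) (x i))" for x
  define B where "B t = {x \<in> space ?P. c + (t + t\<^sup>2) * \<mu> \<le> t * S x}" for t
  have [measurable]: "S \<in> borel_measurable ?P"
    unfolding S_def
  proof (rule borel_measurable_sum)
    fix i assume i: "i \<in> I"
    show "(\<lambda>x. indicator (A i) (x i) :: real) \<in> borel_measurable ?P"
      by (rule measurable_compose[OF measurable_component_singleton[OF i]])
        (rule borel_measurable_indicator[OF A[OF i]])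
  qed
  have B: "B t \<in> sets ?P" for t
    unfolding B_def by measurable
  have "?E \<subseteq> B \<tau> \<union> B (- \<tau>)"
  proof
    fix x assume x: "x \<in> ?E"
    have c: "\<tau> * (c / \<tau>) = c" using \<tau> by simp
    from x have "\<tau> * \<mu> + c / \<tau> \<le> \<bar>S x - \<mu>\<bar>" by (simp add: S_def)
    then have "\<tau> * \<mu> + c / \<tau> \<le> S x - \<mu> \<or> \<tau> * \<mu> + c / \<tau> \<le> \<mu> - S x" by linarith
    then have "\<tau> * (\<tau> * \<mu> + c / \<tau>) \<le> \<tau> * (S x - \<mu>) \<or> \<tau> * (\<tau> * \<mu> + c / \<tau>) \<le> \<tau> * (\<mu> - S x)"
      using \<tau> by (simp add: mult_le_cancel_left_pos)
    then have "c + (\<tau> + \<tau>\<^sup>2) * \<mu> \<le> \<tau> * S x \<or> c + (- \<tau> + (-\<tau>)\<^sup>2) * \<mu> \<le> - \<tau> * S x"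
      unfolding distrib_left c by (simp add: algebra_simps power2_eq_square)
    then show "x \<in> B \<tau> \<union> B (- \<tau>)"
      using x by (simp add: B_def)
  qed
  then have "measure ?P ?E \<le> measure ?P (B \<tau> \<union> B (- \<tau>))"
    using B by (intro P.finite_measure_mono) auto
  also have "\<dots> \<le> measure ?P (B \<tau>) + measure ?P (B (- \<tau>))"
    using B by (intro measure_Un_le) auto
  also have "\<dots> \<le> exp (- c) + exp (- c)"
    unfolding \<mu>_def B_def S_def using \<tau>
    by (intro add_mono prob_sum_indicator_exponential_bound[OF sf fin prob A]) auto
  finally show ?thesis by simp
qed

subsection \<open>Sums of exponential variables\<close>

lemma exp_law_component_distributed:
  assumes "i \<in> {1..m * n + 1}"
  shows "distributed (exp_law m n) lborel (\<lambda>w. w i) (exponential_density 1)"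
proof -
  let ?D = "density lborel (\<lambda>x. ennreal (exponential_density 1 x))"
  have "distr (exp_law m n) ?D (\<lambda>w. w i) = ?D"
    unfolding exp_law_def
    by (rule distr_PiM_component[OF _ assms]) (simp add: prob_space_exponential_density)
  moreover have "distr (exp_law m n) lborel (\<lambda>w. w i) = distr (exp_law m n) ?D (\<lambda>w. w i)"
    by (rule distr_cong) auto
  moreover have "(\<lambda>w. w i) \<in> measurable (exp_law m n) lborel"
    unfolding measurable_cong_sets[OF sets_exp_law sets_lborel]
    using assms by (rule measurable_component_singleton)
  ultimately show ?thesis by (simp add: distributed_def)
qed

text \<open>The family of coordinates is the identity map of the product space, so its joint law is
  the product of the marginal laws.\<close>

lemma exp_law_indep_vars:
  "prob_space.indep_vars (exp_law m n) (\<lambda>_. borel) (\<lambda>i w. w i) {1..m * n + 1}"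
proof -
  let ?J = "{1..m * n + 1}"
  let ?D = "density lborel (\<lambda>x. ennreal (exponential_density 1 x))"
  interpret prob_space "exp_law m n" by (rule prob_space_exp_law)
  have "random_variable borel (\<lambda>w. w i)" if "i \<in> ?J" for i
    using distributed_measurable[OF exp_law_component_distributed[OF that]] by simp
  moreover have "distr (exp_law m n) (PiM ?J (\<lambda>_. borel)) (\<lambda>w. \<lambda>i\<in>?J. w i)
      = distr (exp_law m n) (exp_law m n) (\<lambda>w. w)"
    by (rule distr_cong[OF refl sets_exp_law[symmetric]])
      (auto simp: exp_law_def space_PiM intro!: PiE_restrict)
  moreover have "distr (exp_law m n) borel (\<lambda>w. w i) = ?D" if "i \<in> ?J" for i
  proof -
    have "distr (exp_law m n) borel (\<lambda>w. w i) = distr (exp_law m n) lborel (\<lambda>w. w i)"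
      by (rule distr_cong) auto
    then show ?thesis
      using distributed_distr_eq_density[OF exp_law_component_distributed[OF that]] by simp
  qed
  then have "PiM ?J (\<lambda>i. distr (exp_law m n) borel (\<lambda>w. w i)) = exp_law m n"
    unfolding exp_law_def[of m n] by (intro PiM_cong refl)
  ultimately show ?thesis
    by (subst indep_vars_iff_distr_eq_PiM') (auto simp: distr_id)
qed

text \<open>The shape parameter is shifted by one: \<open>erlang_density k\<close> belongs to
  \<open>k + 1\<close> exponential summands. General index sets are allowed because both initial
  sums and block sums are needed.\<close>

lemma exp_law_sum_distributed:
  assumes I: "I \<subseteq> {1..m * n + 1}" "I \<noteq> {}"
  shows "distributed (exp_law m n) lborel (\<lambda>w. \<Sum>i\<in>I. w i) (erlang_density (card I - 1) 1)"
proof -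
  interpret prob_space "exp_law m n" by (rule prob_space_exp_law)
  show ?thesis
    using I by (intro exponential_distributed_sum indep_vars_subset[OF exp_law_indep_vars]
        exp_law_component_distributed) (auto intro: finite_subset)
qed

section \<open>Erlang laws: small values, large values, inverse moments\<close>

context prob_space
begin

text \<open>On \<open>[0, y]\<close> the density is at most \<open>y ^ k\<close>, and the interval
  has length \<open>y\<close>. With \<open>k = m - 1\<close> this yields the power
  \<open>y ^ m\<close> that governs the exponents of the theorem.\<close>

lemma prob_erlang_le_power:
  fixes y :: real
  assumes D: "distributed M lborel X (erlang_density k 1)" and y: "0 \<le> y"
  shows "\<P>(x in M. X x \<le> y) \<le> y ^ (k + 1)"
proof -
  have "emeasure M (X -` {..y} \<inter> space M) = (\<integral>\<^sup>+x. ennreal (erlang_density k 1 x) * indicator {..y} x \<partial>lborel)"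
    using D by (rule distributed_emeasure) simp
  also have "\<dots> \<le> (\<integral>\<^sup>+x. ennreal (y ^ k) * indicator {0..y} x \<partial>lborel)"
  proof (intro nn_integral_mono)
    fix x :: real
    have "erlang_density k 1 x \<le> y ^ k" if "0 \<le> x" "x \<le> y"
    proof -
      have "x ^ k * exp (- x) / fact k \<le> x ^ k * 1 / 1"
        using that by (intro frac_le mult_left_mono) (auto simp: fact_ge_1)
      also have "\<dots> \<le> y ^ k" using that by (simp add: power_mono)
      finally show ?thesis using that by (simp add: erlang_density_def)
    qed
    then show "ennreal (erlang_density k 1 x) * indicator {..y} x \<le> ennreal (y ^ k) * indicator {0..y} x"
      by (cases "0 \<le> x") (auto simp: indicator_def ennreal_leI erlang_density_def)
  qed
  also have "\<dots> = ennreal (y ^ (k + 1))"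
    using y by (simp add: nn_integral_cmult ennreal_mult'[symmetric] mult.commute)
  also have "X -` {..y} \<inter> space M = {x \<in> space M. X x \<le> y}" by auto
  finally show ?thesis
    using y by (simp add: emeasure_eq_measure)
qed

text \<open>Exponential Markov inequality with parameter \<open>1 / 2\<close>: the moment is
  \<open>2 ^ (k + 1)\<close>, at most \<open>exp 1 ^ (k + 1)\<close>, while the threshold
  contributes \<open>exp (- 2 * (k + 1))\<close>.\<close>

lemma prob_erlang_gt_le_exp:
  assumes D: "distributed M lborel X (erlang_density k 1)"
  shows "\<P>(x in M. 4 * real (k + 1) < X x) \<le> exp (- real (k + 1))"
proof -
  have [measurable]: "X \<in> borel_measurable M" using distributed_measurable[OF D] by simp
  have "(\<integral>\<^sup>+x. ennreal (exp (X x / 2)) \<partial>M) = (\<integral>\<^sup>+x. erlang_density k 1 x * ennreal (exp (x / 2)) \<partial>lborel)"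
    by (rule distributed_nn_integral[OF D, symmetric]) simp
  \<comment> \<open>Tilting by \<open>exp (x / 2)\<close> turns the density of rate \<open>1\<close>
    into \<open>2 ^ (k + 1)\<close> times the density of rate \<open>1 / 2\<close>, whose total mass
    is evaluated below as a zeroth moment.\<close>
  also have "\<dots> = (\<integral>\<^sup>+x. ennreal (2 ^ (k + 1)) * ennreal (erlang_density k (1 / 2) x) \<partial>lborel)"
  proof (intro nn_integral_cong)
    fix x :: real
    have "x / 2 - x = - (x / 2)" by simp
    then have e: "exp (- x) * exp (x / 2) = exp (- (x / 2))"
      by (simp only: exp_add[symmetric]) simp
    have "erlang_density k 1 x * exp (x / 2) = 2 ^ (k + 1) * erlang_density k (1 / 2) x"
      using e by (simp add: erlang_density_def power_divide)
    then show "erlang_density k 1 x * ennreal (exp (x / 2)) = ennreal (2 ^ (k + 1)) * ennreal (erlang_density k (1 / 2) x)"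
      by (simp add: ennreal_mult'[symmetric] del: power_Suc)
  qed
  also have "\<dots> = ennreal (2 ^ (k + 1))"
    using nn_integral_erlang_ith_moment[of "1/2" k 0] by (subst nn_integral_cmult) (auto simp del: power_Suc)
  finally have I: "(\<integral>\<^sup>+x. ennreal (exp (X x / 2)) \<partial>M) = ennreal (2 ^ (k + 1))" .
  have hb: "has_bochner_integral M (\<lambda>x. exp (X x / 2)) (2 ^ (k + 1))"
    using I by (intro has_bochner_integral_nn_integral) auto
  have "\<P>(x in M. 4 * real (k + 1) < X x) \<le> \<P>(x in M. exp (2 * real (k + 1)) \<le> exp (X x / 2))"
    by (intro finite_measure_mono) (auto simp del: of_nat_add of_nat_Suc)
  also have "\<dots> \<le> (\<integral>x. exp (X x / 2) \<partial>M) / exp (2 * real (k + 1))"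
    using hb by (intro integral_Markov_inequality_measure[OF _ sets.top]) (auto simp: has_bochner_integral_iff)
  also have "\<dots> = 2 ^ (k + 1) / exp (2 * real (k + 1))"
    using hb by (simp add: has_bochner_integral_iff)
  also have "\<dots> \<le> exp 1 ^ (k + 1) / exp (2 * real (k + 1))"
    using exp_ge_add_one_self[of 1] by (intro divide_right_mono power_mono) auto
  also have "\<dots> = exp (- real (k + 1))"
    by (simp add: exp_of_nat_mult[symmetric] exp_diff[symmetric] del: of_nat_add of_nat_Suc power_Suc)
  finally show ?thesis .
qed

lemma erlang_AE_pos:
  assumes D: "distributed M lborel X (erlang_density k 1)"
  shows "AE x in M. 0 < X x"
proof (subst distributed_AE2[OF D])
  have "AE x in lborel. x \<noteq> (0::real)" by (rule AE_lborel_singleton)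
  then show "AE x in lborel. 0 < ennreal (erlang_density k 1 x) \<longrightarrow> 0 < x"
    by eventually_elim (auto simp: erlang_density_def not_less split: if_splits)
qed simp

text \<open>Dividing the density by \<open>x\<close> lowers the shape by one and leaves the factor
  \<open>1 / k\<close>. For \<open>k = 0\<close> the integral diverges at the origin.\<close>

lemma erlang_inverse_moment:
  assumes D: "distributed M lborel X (erlang_density k 1)" and k: "0 < k"
  shows "has_bochner_integral M (\<lambda>x. 1 / X x) (1 / real k)"
proof (rule has_bochner_integral_nn_integral)
  have [measurable]: "X \<in> borel_measurable M" using distributed_measurable[OF D] by simp
  show "(\<lambda>x. 1 / X x) \<in> borel_measurable M" by measurable
  show "AE x in M. 0 \<le> 1 / X x" using erlang_AE_pos[OF D] by eventually_elim simp
  have "(\<integral>\<^sup>+x. ennreal (1 / X x) \<partial>M) = (\<integral>\<^sup>+x. erlang_density k 1 x * ennreal (1 / x) \<partial>lborel)"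
    by (rule distributed_nn_integral[OF D, symmetric]) simp
  also have "\<dots> = (\<integral>\<^sup>+x. ennreal (1 / real k) * ennreal (erlang_density (k - 1) 1 x) \<partial>lborel)"
  proof (rule nn_integral_cong_AE)
    have "AE x in lborel. x \<noteq> (0::real)" by (rule AE_lborel_singleton)
    then show "AE x in lborel. erlang_density k 1 x * ennreal (1 / x)
        = ennreal (1 / real k) * ennreal (erlang_density (k - 1) 1 x)"
    proof eventually_elim
      case (elim x)
      obtain j where j: "k = Suc j" using k gr0_conv_Suc by auto
      show ?case
      proof (cases "x < 0")
        case False
        then have "erlang_density k 1 x * (1 / x) = 1 / real k * erlang_density (k - 1) 1 x"
          using elim by (simp add: erlang_density_def j field_simps)
        then show ?thesis using False k by (simp add: ennreal_mult'[symmetric])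
      qed (simp add: erlang_density_def)
    qed
  qed
  also have "\<dots> = ennreal (1 / real k)"
    using nn_integral_erlang_ith_moment[of 1 "k - 1" 0] by (subst nn_integral_cmult) auto
  finally show "(\<integral>\<^sup>+x. ennreal (1 / X x) \<partial>M) = ennreal (1 / real k)" .
qed simp

end

text \<open>By AM-GM. The right-hand side involves only \<open>x\<close> and \<open>1 / x\<close>, whose expectations under the
  Erlang law are explicit.\<close>

lemma abs_inverse_sqrt_diff_le:
  fixes x k :: real
  assumes "0 < x" "0 < k"
  shows "\<bar>1 / sqrt x - 1 / sqrt k\<bar> \<le> (x - 2 * k + k\<^sup>2 * (1 / x) + 1) / (2 * k)"
proof -
  define s r where "s = sqrt x" and "r = sqrt k"
  have sr: "0 < s" "0 < r" "x = s\<^sup>2" "k = r\<^sup>2" using assms by (auto simp: s_def r_def)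
  have "\<bar>1 / s - 1 / r\<bar> = \<bar>r - s\<bar> / (r * s)"
    using sr by (simp add: abs_div_pos[symmetric] field_simps abs_mult)
  also have "\<dots> = \<bar>r - s\<bar> * r / (r\<^sup>2 * s)" using sr by (simp add: field_simps power2_eq_square)
  \<comment> \<open>Enlarging \<open>r\<close> to \<open>r + s\<close> makes the numerator
    \<open>\<bar>x - k\<bar>\<close>; its square divided by \<open>x\<close> is a combination of
    \<open>x\<close>, a constant and \<open>1 / x\<close>.\<close>
  also have "\<dots> \<le> \<bar>r - s\<bar> * (r + s) / (r\<^sup>2 * s)"
    using sr by (intro divide_right_mono mult_left_mono) auto
  also have "\<bar>r - s\<bar> * (r + s) = \<bar>x - k\<bar>"
  proof -
    have "\<bar>r - s\<bar> * (r + s) = \<bar>(s - r) * (s + r)\<bar>" using sr by (simp add: abs_mult abs_minus_commute add.commute)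
    then show ?thesis by (simp add: sr(3,4) algebra_simps power2_eq_square)
  qed
  also have "\<bar>x - k\<bar> / (r\<^sup>2 * s) = (2 * (\<bar>x - k\<bar> / s)) / (2 * k)"
    using sr by (simp add: field_simps)
  also have "\<dots> \<le> ((\<bar>x - k\<bar> / s)\<^sup>2 + 1) / (2 * k)"
    using sum_squares_bound[of "\<bar>x - k\<bar> / s" 1] assms by (intro divide_right_mono) auto
  also have "(\<bar>x - k\<bar> / s)\<^sup>2 + 1 = x - 2 * k + k\<^sup>2 * (1 / x) + 1"
    using assms unfolding power_divide sr(3)[symmetric] by (simp add: field_simps power2_eq_square)
  finally show ?thesis by (simp add: s_def r_def)
qed

text \<open>Taking expectations in the preceding pointwise bound, the terms of order
  \<open>k\<close> in the numerator cancel, so the mean error is of order \<open>1 / k\<close> and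
  its sum over \<open>k\<close> only logarithmic.\<close>

lemma (in prob_space) erlang_expectation_inverse_sqrt:
  assumes D: "distributed M lborel X (erlang_density k 1)" and k: "0 < k"
  shows "integrable M (\<lambda>x. \<bar>1 / sqrt (X x) - 1 / sqrt (real (k + 1))\<bar>)"
    and "expectation (\<lambda>x. \<bar>1 / sqrt (X x) - 1 / sqrt (real (k + 1))\<bar>) \<le> 3 / (2 * real (k + 1))"
proof -
  let ?K = "real (k + 1)"
  define h where "h x = (X x - 2 * ?K + ?K\<^sup>2 * (1 / X x) + 1) / (2 * ?K)" for x
  have [measurable]: "X \<in> borel_measurable M" using distributed_measurable[OF D] by simp
  have X: "integrable M X" "expectation X = ?K"
    using erlang_ith_moment_integrable[OF _ D, of 1] erlang_ith_moment[OF _ D, of 1] by auto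
  have Y: "integrable M (\<lambda>x. 1 / X x)" "expectation (\<lambda>x. 1 / X x) = 1 / real k"
    using erlang_inverse_moment[OF D k] by (auto simp: has_bochner_integral_iff)
  have const: "has_bochner_integral M (\<lambda>_. c) c" for c :: real
    by (simp add: has_bochner_integral_iff prob_space)
  have "has_bochner_integral M h ((?K - 2 * ?K + ?K\<^sup>2 * (1 / real k) + 1) / (2 * ?K))"
    unfolding h_def using X Y
    by (intro has_bochner_integral_divide_zero has_bochner_integral_add has_bochner_integral_diff
        has_bochner_integral_mult_right const) (simp_all add: has_bochner_integral_iff)
  then have hi: "integrable M h"
    and "expectation h = (?K - 2 * ?K + ?K\<^sup>2 * (1 / real k) + 1) / (2 * ?K)"
    unfolding has_bochner_integral_iff by blast+
  note this(2)
  also have "\<dots> \<le> 3 / (2 * ?K)"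
  proof (intro divide_right_mono)
    \<comment> \<open>With \<open>?K = k + 1\<close> the left-hand side equals
      \<open>2 + 1 / k\<close>.\<close>
    show "?K - 2 * ?K + ?K\<^sup>2 * (1 / real k) + 1 \<le> 3"
      using k by (simp add: field_simps power2_eq_square)
  qed simp
  finally have he: "expectation h \<le> 3 / (2 * ?K)" .
  have AE: "AE x in M. \<bar>1 / sqrt (X x) - 1 / sqrt ?K\<bar> \<le> h x"
    using erlang_AE_pos[OF D]
    by eventually_elim (simp only: h_def, rule abs_inverse_sqrt_diff_le, auto)
  show i: "integrable M (\<lambda>x. \<bar>1 / sqrt (X x) - 1 / sqrt ?K\<bar>)"
    using hi by (rule Bochner_Integration.integrable_bound) (use AE in \<open>auto elim!: eventually_mono\<close>)
  have "expectation (\<lambda>x. \<bar>1 / sqrt (X x) - 1 / sqrt ?K\<bar>) \<le> expectation h"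
    using i hi AE by (rule integral_mono_AE)
  with he show "expectation (\<lambda>x. \<bar>1 / sqrt (X x) - 1 / sqrt ?K\<bar>) \<le> 3 / (2 * ?K)" by simp
qed

subsection \<open>Degrees given the exponential variables\<close>

lemma partial_sum_less:
  assumes "\<And>i. i \<in> {1..N} \<Longrightarrow> 0 < w i" "k < k'" "k' \<le> N"
  shows "partial_sum w k < partial_sum w k'"
  unfolding partial_sum_def using assms by (intro sum_strict_mono2[where b = k']) (auto intro: less_imp_le)

lemma partial_sum_le:
  assumes "\<And>i. i \<in> {1..N} \<Longrightarrow> 0 < w i" "k \<le> k'" "k' \<le> N"
  shows "partial_sum w k \<le> partial_sum w k'"
  using partial_sum_less[of N w k k'] assms by (cases "k = k'") auto

lemma partial_sum_0 [simp]: "partial_sum w 0 = 0"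
  by (simp add: partial_sum_def)

lemma partial_sum_nonneg:
  assumes "\<And>i. i \<in> {1..N} \<Longrightarrow> 0 < w i" "k \<le> N"
  shows "0 \<le> partial_sum w k"
  using partial_sum_le[of N w 0 k] assms by simp

lemma partial_sum_pos:
  assumes "\<And>i. i \<in> {1..N} \<Longrightarrow> 0 < w i" "0 < k" "k \<le> N"
  shows "0 < partial_sum w k"
  using partial_sum_less[of N w 0 k] assms by simp

lemma right_end_pos:
  assumes "\<And>i. i \<in> {1..m * n + 1} \<Longrightarrow> 0 < w i" "0 < k" "k \<le> m * n"
  shows "0 < right_end m n w k"
  unfolding right_end_def using assms by (intro divide_pos_pos partial_sum_pos[of "m * n + 1"]) auto

lemma right_end_mono:
  assumes "\<And>i. i \<in> {1..m * n + 1} \<Longrightarrow> 0 < w i" "k \<le> k'" "k' \<le> m * n"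
  shows "right_end m n w k \<le> right_end m n w k'"
  unfolding right_end_def using assms
  by (intro divide_right_mono partial_sum_le[of "m * n + 1"] partial_sum_nonneg[of "m * n + 1"]) auto

lemma right_end_less:
  assumes "\<And>i. i \<in> {1..m * n + 1} \<Longrightarrow> 0 < w i" "k < k'" "k' \<le> m * n"
  shows "right_end m n w k < right_end m n w k'"
  unfolding right_end_def using assms
  by (intro divide_strict_right_mono partial_sum_less[of "m * n + 1"] partial_sum_pos[of "m * n + 1"]) auto

text \<open>For positive \<open>w\<close> the blocks are disjoint and exhaust the range of
  \<open>x\<close>, so the \<open>LEAST\<close> in \<open>vertex_of\<close> is the unique candidate
  and membership can be tested for \<open>j\<close> alone.\<close>

lemma vertex_of_eq_iff:
  assumes w: "\<And>i. i \<in> {1..m * n + 1} \<Longrightarrow> 0 < w i" and j: "j \<in> {1..n}"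
    and x: "0 < x" "x \<le> right_end m n w (m * n)"
  shows "vertex_of m n w x = j \<longleftrightarrow> x \<in> {right_end m n w (m * (j - 1)) <.. right_end m n w (m * j)}"
proof -
  let ?P = "\<lambda>i. i \<in> {1..n} \<and> x \<in> {right_end m n w (m * (i - 1)) <.. right_end m n w (m * i)}"
  \<comment> \<open>The first block boundary that reaches \<open>x\<close>: minimality supplies the
    strict inequality at the left end, and \<open>i\<close> is not \<open>0\<close> because
    \<open>right_end\<close> vanishes there.\<close>
  define i where "i = (LEAST i. x \<le> right_end m n w (m * i))"
  have i: "x \<le> right_end m n w (m * i)" "i \<le> n"
    unfolding i_def using x(2) by (rule LeastI, rule Least_le)
  have i0: "i \<noteq> 0" using i(1) x(1) by (cases "i = 0") (simp_all add: right_end_def)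
  have "\<not> x \<le> right_end m n w (m * (i - 1))"
    unfolding i_def[symmetric] using i0 not_less_Least[of "i - 1" "\<lambda>i. x \<le> right_end m n w (m * i)"]
    by (auto simp: i_def[symmetric])
  with i i0 have Pi: "?P i" by auto
  have uniq: "a = b" if "?P a" "?P b" for a b
  proof -
    have False if ab: "?P a" "?P b" "a < b" for a b
    proof -
      have le: "m * a \<le> m * (b - 1)" "m * (b - 1) \<le> m * n"
        using ab by (intro mult_le_mono2; auto)+
      have "right_end m n w (m * a) \<le> right_end m n w (m * (b - 1))"
        by (rule right_end_mono[OF _ le], rule w)
      then show False using ab by auto
    qed
    then show ?thesis using that by (metis linorder_neqE_nat)
  qed
  have v: "vertex_of m n w x = i"
    unfolding vertex_of_def
    by (rule Least_equality) (use Pi uniq in blast, use Pi uniq in \<open>metis order_refl\<close>)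
  show ?thesis
    unfolding v using Pi uniq j by blast
qed

lemma measure_left_density_Ioc:
  fixes r u v :: real
  assumes "0 < r" "0 \<le> u" "u \<le> v" "v \<le> r"
  shows "measure (density lborel (\<lambda>x. ennreal (left_density r x))) {u<..v} = (sqrt v - sqrt u) / sqrt r"
proof -
  have 1: "((\<lambda>x. 1 / (2 * sqrt (r * x))) has_integral (sqrt (v / r) - sqrt (u / r))) {u..v}"
  \<comment> \<open>The interior form is used because for \<open>u = 0\<close> the antiderivative
    \<open>sqrt (x / r)\<close> has infinite slope at the left end.\<close>
  proof (rule fundamental_theorem_of_calculus_interior)
    show "continuous_on {u..v} (\<lambda>x. sqrt (x / r))"
      using assms by (intro continuous_intros) auto
    fix x assume x: "x \<in> {u<..<v}"
    then have x0: "0 < x" using assms by auto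
    have "sqrt r * sqrt r = r" using assms by simp
    then have e: "inverse (sqrt (x / r)) / 2 * (1 / r) = 1 / (2 * sqrt (r * x))"
      using x0 assms by (simp add: real_sqrt_mult real_sqrt_divide field_simps)
    have "((\<lambda>x. sqrt (x / r)) has_real_derivative (inverse (sqrt (x / r)) / 2 * (1 / r))) (at x)"
      using x0 assms by (auto intro!: derivative_eq_intros simp: divide_simps)
    then show "((\<lambda>x. sqrt (x / r)) has_vector_derivative 1 / (2 * sqrt (r * x))) (at x)"
      unfolding e has_real_derivative_iff_has_vector_derivative .
  qed (use assms in auto)
  have 2: "((\<lambda>x. if x \<in> {u..v} then 1 / (2 * sqrt (r * x)) else 0) has_integral
      (sqrt (v / r) - sqrt (u / r))) UNIV"
    using 1 by (subst has_integral_restrict_UNIV)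
  have "((\<lambda>x. left_density r x * indicator {u<..v} x) has_integral (sqrt (v / r) - sqrt (u / r))) UNIV"
    by (rule has_integral_spike[OF _ _ 2, of "{u}"])
      (use assms in \<open>auto simp: left_density_def indicator_def\<close>)
  then have "(\<integral>\<^sup>+x. ennreal (left_density r x * indicator {u<..v} x) \<partial>lborel)
      = ennreal (sqrt (v / r) - sqrt (u / r))"
    by (intro nn_integral_has_integral_lborel) (auto simp: left_density_def[abs_def])
  moreover have "ennreal (left_density r x * indicator {u<..v} x)
      = ennreal (left_density r x) * indicator {u<..v} x" for x
    by (auto simp: indicator_def)
  ultimately have "emeasure (density lborel (\<lambda>x. ennreal (left_density r x))) {u<..v}
      = ennreal (sqrt (v / r) - sqrt (u / r))"
    by (subst emeasure_density) auto
  then have "measure (density lborel (\<lambda>x. ennreal (left_density r x))) {u<..v} = sqrt (v / r) - sqrt (u / r)"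
    using assms by (intro measure_eq_emeasure_eq_ennreal) (auto simp: divide_right_mono)
  then show ?thesis by (simp add: real_sqrt_divide diff_divide_distrib)
qed

lemma measure_left_density_beyond:
  assumes "r \<le> u"
  shows "measure (density lborel (\<lambda>x. ennreal (left_density r x))) {u<..v} = 0"
proof -
  have "(\<lambda>x. ennreal (left_density r x) * indicator {u<..v} x) = (\<lambda>_. 0)"
    using assms by (auto simp: left_density_def indicator_def fun_eq_iff)
  then show ?thesis by (simp add: measure_def emeasure_density)
qed

section \<open>The left ends and the degrees for fixed positive \<open>w\<close>\<close>

lemma prob_space_left_density:
  "0 < r \<Longrightarrow> prob_space (density lborel (\<lambda>x. ennreal (left_density r x)))"
  by (rule prob_spaceI) (simp add: emeasure_density nn_integral_left_density)

lemma product_sigma_finite_left_density: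
  "product_sigma_finite (\<lambda>k. density lborel (\<lambda>x. ennreal (left_density (r k) x)))"
proof -
  have "finite_measure (density lborel (\<lambda>x. ennreal (left_density (r k) x)))" for k
    by (rule finite_measureI) (simp add: emeasure_density nn_integral_left_density)
  then show ?thesis
    unfolding product_sigma_finite_def by (auto intro: finite_measure.axioms)
qed

lemma prob_space_left_law:
  assumes "\<And>i. i \<in> {1..m * n + 1} \<Longrightarrow> 0 < w i"
  shows "prob_space (left_law m n w)"
  unfolding left_law_def using assms
  by (intro prob_space_PiM prob_space_left_density right_end_pos) auto

lemma AE_left_law_le_right_end:
  assumes w: "\<And>i. i \<in> {1..m * n + 1} \<Longrightarrow> 0 < w i"
  shows "AE l in left_law m n w. \<forall>k\<in>{1..m * n}. 0 < l k \<and> l k \<le> right_end m n w k"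
proof -
  have "AE l in left_law m n w. 0 < l k \<and> l k \<le> right_end m n w k" if k: "k \<in> {1..m * n}" for k
    unfolding left_law_def
  proof (rule AE_PiM_component[OF _ k])
    show "prob_space (density lborel (\<lambda>x. ennreal (left_density (right_end m n w i) x)))"
      if "i \<in> {1..m * n}" for i
      using that w by (intro prob_space_left_density right_end_pos) auto
    show "AE x in density lborel (\<lambda>x. ennreal (left_density (right_end m n w k) x)).
        0 < x \<and> x \<le> right_end m n w k"
      by (subst AE_density) (auto simp: left_density_def)
  qed
  then show ?thesis by (simp add: AE_finite_all)
qed

text \<open>Exactly \<open>m\<close> right ends lie in block \<open>j\<close>, whatever the left
  ends are, so only the left ends carry randomness once \<open>w\<close> is fixed. A loop is counted
  once in each of the two sums, hence twice.\<close>

lemma attach_degree_eq_count: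
  assumes w: "\<And>i. i \<in> {1..m * n + 1} \<Longrightarrow> 0 < w i" and j: "j \<in> {1..n}"
    and l: "\<And>k. k \<in> {1..m * n} \<Longrightarrow> 0 < l k \<and> l k \<le> right_end m n w k"
  shows "real (attach_degree m n (w, l) j) = real m
    + (\<Sum>k=1..m * n. indicator {right_end m n w (m * (j - 1)) <.. right_end m n w (m * j)} (l k))"
proof -
  let ?J = "{right_end m n w (m * (j - 1)) <.. right_end m n w (m * j)}"
  have mj: "m * j \<le> m * n" "m * (j - 1) \<le> m * n" "m * j = m * (j - 1) + m"
    using j by (intro mult_le_mono2; auto)+ (use j in \<open>auto simp: diff_mult_distrib2\<close>)
  have R: "vertex_of m n w (right_end m n w k) = j \<longleftrightarrow> k \<in> {m * (j - 1) <.. m * j}"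
    if k: "k \<in> {1..m * n}" for k
  proof -
    have iff: "right_end m n w a < right_end m n w b \<longleftrightarrow> a < b" if "a \<le> m * n" "b \<le> m * n" for a b
    proof (cases "a < b")
      case True
      have "right_end m n w a < right_end m n w b" by (rule right_end_less[OF _ True that(2)], rule w)
      with True show ?thesis by simp
    next
      case False
      then have "b \<le> a" by simp
      have "right_end m n w b \<le> right_end m n w a" by (rule right_end_mono[OF _ \<open>b \<le> a\<close> that(1)], rule w)
      with False show ?thesis by simp
    qed
    have "vertex_of m n w (right_end m n w k) = j \<longleftrightarrow> right_end m n w k \<in> ?J"
      using k by (intro vertex_of_eq_iff w j right_end_pos right_end_mono) auto
    also have "\<dots> \<longleftrightarrow> k \<in> {m * (j - 1) <.. m * j}"
      using iff[of "m * (j - 1)" k] iff[of "m * j" k] k mj by (auto simp: not_less[symmetric])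
    finally show ?thesis .
  qed
  have L: "vertex_of m n w (l k) = j \<longleftrightarrow> l k \<in> ?J" if k: "k \<in> {1..m * n}" for k
    using l[OF k] right_end_mono[of m n w k "m * n"] w k by (intro vertex_of_eq_iff w j) auto
  have "(\<Sum>k=1..m * n. of_bool (vertex_of m n w (right_end m n w k) = j) :: real)
      = (\<Sum>k=1..m * n. of_bool (k \<in> {m * (j - 1) <.. m * j}))"
    using R by (intro sum.cong) auto
  also have "\<dots> = real (card ({1..m * n} \<inter> {m * (j - 1) <.. m * j}))"
    by (simp add: of_bool_def sum.If_cases greaterThanAtMost_def greaterThan_def atMost_def Collect_conj_eq)
  also have "{1..m * n} \<inter> {m * (j - 1) <.. m * j} = {m * (j - 1) <.. m * j}"
    using mj by auto
  also have "real (card \<dots>) = real m" using mj by simp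
  finally have 1: "(\<Sum>k=1..m * n. of_bool (vertex_of m n w (right_end m n w k) = j) :: real) = real m" .
  have 2: "(\<Sum>k=1..m * n. of_bool (vertex_of m n w (l k) = j) :: real) = (\<Sum>k=1..m * n. indicator ?J (l k))"
    using L by (intro sum.cong) (auto simp: indicator_def)
  show ?thesis
    unfolding attach_degree_eq fst_conv snd_conv of_nat_sum of_nat_add of_nat_of_bool sum.distrib 1 2 ..
qed

text \<open>Transfers conditional bounds to the joint law: the measure of \<open>A\<close> is the
  integral of its section probabilities, hence at least \<open>(1 - q)\<close> times the measure of
  \<open>G\<close>. Positivity of \<open>w\<close> may be assumed because it holds almost
  everywhere.\<close>

lemma measure_attach_law_ge:
  assumes A: "A \<in> sets (attach_law m n)" and G: "G \<in> sets (exp_law m n)" and q: "0 \<le> q"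
    and le: "\<And>w. w \<in> G \<Longrightarrow> (\<And>i. i \<in> {1..m * n + 1} \<Longrightarrow> 0 < w i) \<Longrightarrow>
      1 - q \<le> measure (left_law m n w) {l \<in> space (left_law m n w). (w, l) \<in> A}"
  shows "measure (exp_law m n) G - q \<le> measure (attach_law m n) A"
proof (cases "q \<le> 1")
  case True
  let ?W = "PiM {1..m * n + 1} (\<lambda>_. borel) :: (nat \<Rightarrow> real) measure"
  let ?L = "PiM {1..m * n} (\<lambda>_. borel) :: (nat \<Rightarrow> real) measure"
  interpret E: prob_space "exp_law m n" by (rule prob_space_exp_law)
  interpret P: prob_space "attach_law m n" by (rule prob_space_attach_law)
  have sp: "space (exp_law m n) = space ?W" by (rule sets_eq_imp_space_eq[OF sets_exp_law])
  have K: "(\<lambda>w. left_law m n w \<bind> (\<lambda>l. return (?W \<Otimes>\<^sub>M ?L) (w, l)))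
      \<in> measurable (exp_law m n) (subprob_algebra (?W \<Otimes>\<^sub>M ?L))"
    by measurable
  have A': "A \<in> sets (?W \<Otimes>\<^sub>M ?L)" using A sets_attach_law by blast
  \<comment> \<open>Binding with \<open>return\<close> is the image of \<open>left_law m n w\<close>
    under \<open>l \<mapsto> (w, l)\<close>, so the kernel evaluates \<open>A\<close> on its section
    at \<open>w\<close>.\<close>
  have sect: "emeasure (left_law m n w \<bind> (\<lambda>l. return (?W \<Otimes>\<^sub>M ?L) (w, l))) A
      = ennreal (measure (left_law m n w) {l \<in> space (left_law m n w). (w, l) \<in> A})"
    if "w \<in> space (exp_law m n)" for w
  proof -
    have w: "w \<in> space ?W" using that sp by simp
    have "left_law m n w \<in> space (subprob_algebra ?L)"
      using measurable_space[OF left_law_measurable w] .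
    then interpret Lw: subprob_space "left_law m n w" by (simp add: space_subprob_algebra)
    have f: "(\<lambda>l. (w, l)) \<in> measurable (left_law m n w) (?W \<Otimes>\<^sub>M ?L)" using w by measurable
    have "emeasure (left_law m n w \<bind> (\<lambda>l. return (?W \<Otimes>\<^sub>M ?L) (w, l))) A
        = emeasure (left_law m n w) ((\<lambda>l. (w, l)) -` A \<inter> space (left_law m n w))"
      using f A' Lw.subprob_not_empty by (subst bind_return_distr') (auto simp: emeasure_distr)
    also have "(\<lambda>l. (w, l)) -` A \<inter> space (left_law m n w) = {l \<in> space (left_law m n w). (w, l) \<in> A}"
      by auto
    finally show ?thesis by (simp add: Lw.emeasure_eq_measure)
  qed
  have "ennreal ((1 - q) * measure (exp_law m n) G) = (\<integral>\<^sup>+w. ennreal (1 - q) * indicator G w \<partial>exp_law m n)"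
    using G True by (simp add: nn_integral_cmult_indicator ennreal_mult E.emeasure_eq_measure)
  also have "\<dots> \<le> (\<integral>\<^sup>+w. emeasure (left_law m n w \<bind> (\<lambda>l. return (?W \<Otimes>\<^sub>M ?L) (w, l))) A \<partial>exp_law m n)"
  proof (rule nn_integral_mono_AE)
    show "AE w in exp_law m n. ennreal (1 - q) * indicator G w
        \<le> emeasure (left_law m n w \<bind> (\<lambda>l. return (?W \<Otimes>\<^sub>M ?L) (w, l))) A"
      using AE_exp_law_pos AE_space
    proof eventually_elim
      case (elim w)
      then show ?case using le[of w] sect[of w] by (auto simp: indicator_def intro!: ennreal_leI)
    qed
  qed
  also have "\<dots> = emeasure (attach_law m n) A"
    unfolding attach_law_def by (rule emeasure_bind[OF E.not_empty K A', symmetric])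
  finally have "(1 - q) * measure (exp_law m n) G \<le> measure (attach_law m n) A"
    by (simp add: P.emeasure_eq_measure)
  moreover have "q * measure (exp_law m n) G \<le> q * 1"
    using q by (intro mult_left_mono) auto
  ultimately show ?thesis by (simp add: algebra_simps)
next
  case False
  interpret E: prob_space "exp_law m n" by (rule prob_space_exp_law)
  have "measure (exp_law m n) G - q \<le> 0" using False E.prob_le_1[of G] by linarith
  then show ?thesis using measure_nonneg[of "attach_law m n" A] by linarith
qed

text \<open>Telescoping: \<open>1 / sqrt (k + 1)\<close> lies between the increments of
  \<open>2 * sqrt\<close> over \<open>[k + 1, k + 2]\<close> and over
  \<open>[k, k + 1]\<close>.\<close>

lemma sum_inverse_sqrt_bound:
  assumes "a \<le> N"
  shows "\<bar>(\<Sum>k=a+1..N. 1 / sqrt (real k)) - 2 * sqrt (real N)\<bar> \<le> 2 * sqrt (real (a + 1))"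
proof -
  have incr: "1 / sqrt (real (k + 1)) \<le> 2 * sqrt (real (k + 1)) - 2 * sqrt (real k)"
    "2 * sqrt (real (k + 2)) - 2 * sqrt (real (k + 1)) \<le> 1 / sqrt (real (k + 1))" for k
  proof -
    have e: "(sqrt (x + 1) - sqrt x) * (sqrt (x + 1) + sqrt x) = 1" if "0 \<le> x" for x :: real
      using that by (simp add: algebra_simps)
    have p: "0 < sqrt (real k + 1) + sqrt (real k)" by (intro add_pos_nonneg) auto
    have "1 / sqrt (real k + 1) = 2 / (sqrt (real k + 1) + sqrt (real k + 1))" by simp
    also have "\<dots> \<le> 2 / (sqrt (real k + 1) + sqrt (real k))"
      using p by (intro divide_left_mono) auto
    also have "\<dots> = 2 * sqrt (real k + 1) - 2 * sqrt (real k)"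
      using e[of "real k"] p by (simp add: field_simps)
    finally show "1 / sqrt (real (k + 1)) \<le> 2 * sqrt (real (k + 1)) - 2 * sqrt (real k)"
      by (simp add: add.commute)
    have q: "0 < sqrt (real k + 1 + 1) + sqrt (real k + 1)" by (intro add_pos_nonneg) auto
    have "2 * sqrt (real k + 1 + 1) - 2 * sqrt (real k + 1) = 2 / (sqrt (real k + 1 + 1) + sqrt (real k + 1))"
      using e[of "real k + 1"] q by (simp add: field_simps)
    also have "\<dots> \<le> 2 / (sqrt (real k + 1) + sqrt (real k + 1))"
      using q by (intro divide_left_mono mult_pos_pos) auto
    also have "\<dots> = 1 / sqrt (real k + 1)" by simp
    finally show "2 * sqrt (real (k + 2)) - 2 * sqrt (real (k + 1)) \<le> 1 / sqrt (real (k + 1))"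
      by (simp add: add.commute)
  qed
  from assms have "(\<Sum>k=a+1..N. 1 / sqrt (real k)) \<le> 2 * sqrt (real N) - 2 * sqrt (real a) \<and>
    2 * sqrt (real (N + 1)) - 2 * sqrt (real (a + 1)) \<le> (\<Sum>k=a+1..N. 1 / sqrt (real k))"
  proof (induction N rule: dec_induct)
    case (step N)
    have "(\<Sum>k=a+1..Suc N. 1 / sqrt (real k)) = (\<Sum>k=a+1..N. 1 / sqrt (real k)) + 1 / sqrt (real (N + 1))"
      using step.hyps by (simp add: add.commute)
    with step.IH incr[of N] show ?case by simp
  qed simp
  moreover have "sqrt (real N) \<le> sqrt (real (N + 1))" "0 \<le> sqrt (real a)" "0 \<le> sqrt (real (a + 1))" by auto
  ultimately show ?thesis by linarith
qed

lemma sum_inverse_le_ln: "1 \<le> N \<Longrightarrow> (\<Sum>k=2..N. 1 / real k) \<le> ln (real N)"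
proof (induction N rule: dec_induct)
  case (step N)
  have "ln (real N / real (Suc N)) \<le> real N / real (Suc N) - 1"
    using step by (intro ln_le_minus_one) auto
  then have "1 / real (Suc N) \<le> ln (real (Suc N)) - ln (real N)"
    using step by (simp add: ln_div field_simps)
  with step show ?case by simp
qed simp

text \<open>Given \<open>w\<close>, a left end \<open>l\<^sub>k\<close> with \<open>k > m j\<close> hits block \<open>j\<close> with probability
  \<open>(sqrt W\<^sub>m\<^sub>j - sqrt W\<^sub>m\<^sub>(\<^sub>j\<^sub>-\<^sub>1\<^sub>)) / sqrt W\<^sub>k\<close>, while the \<open>m\<close> indices of the block itself
  contribute at most \<open>m\<close>. Lumping in \<open>k = m j\<close> keeps \<open>k = 1\<close> out of the error sum, where
  \<open>1 / W\<^sub>1\<close> has no expectation.\<close>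

lemma conditional_mean_approx:
  fixes m n j :: nat
  assumes w: "\<And>i. i \<in> {1..m * n + 1} \<Longrightarrow> 0 < w i" and m: "1 \<le> m" and j: "j \<in> {1..n}"
  defines "p \<equiv> \<lambda>k. measure (density lborel (\<lambda>x. ennreal (left_density (right_end m n w k) x)))
    {right_end m n w (m * (j - 1)) <.. right_end m n w (m * j)}"
  shows "\<bar>(\<Sum>k=1..m * n. p k) - approx_degree m n (w, l) j\<bar> \<le> real m
    + (sqrt (partial_sum w (m * j)) - sqrt (partial_sum w (m * (j - 1))))
      * ((\<Sum>k=2..m * n. \<bar>1 / sqrt (partial_sum w k) - 1 / sqrt (real k)\<bar>) + 2 * sqrt (real (m * j + 1)))"
proof -
  let ?N = "m * n"
  define a where "a = m * (j - 1)"
  define s where "s = sqrt (partial_sum w (m * j)) - sqrt (partial_sum w a)"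
  have ord: "a \<le> m * j" "m * j \<le> ?N" "a \<le> ?N" "m * j = a + m" "1 \<le> m * j"
  proof -
    show "a \<le> m * j" "m * j \<le> ?N" unfolding a_def using j by (intro mult_le_mono2; auto)+
    then show "a \<le> ?N" by linarith
    show "m * j = a + m" unfolding a_def using j by (auto simp: diff_mult_distrib2)
    then show "1 \<le> m * j" using m by linarith
  qed
  have T: "0 < partial_sum w (?N + 1)" by (rule partial_sum_pos[of "?N + 1"]) (use w in auto)
  have a0: "0 \<le> partial_sum w a" by (rule partial_sum_nonneg[of "?N + 1"]) (use ord w in auto)
  have aj: "partial_sum w a \<le> partial_sum w (m * j)"
    by (rule partial_sum_le[of "?N + 1"]) (use ord w in auto)
  have s0: "0 \<le> s" unfolding s_def using aj by simp
  \<comment> \<open>Here \<open>k\<close> precedes the block, so the support of the density of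
    \<open>l k\<close> ends before the block begins.\<close>
  have low: "p k = 0" if "k \<in> {1..a}" for k
    unfolding p_def a_def[symmetric]
    by (rule measure_left_density_beyond, rule right_end_mono) (use w ord that in auto)
  have mid: "0 \<le> p k" "p k \<le> 1" if "k \<in> {a+1..m * j}" for k
  proof -
    interpret prob_space "density lborel (\<lambda>x. ennreal (left_density (right_end m n w k) x))"
      by (rule prob_space_left_density, rule right_end_pos) (use w ord that in auto)
    show "0 \<le> p k" "p k \<le> 1" unfolding p_def by auto
  qed
  \<comment> \<open>The normalising factor \<open>partial_sum w (m * n + 1)\<close> cancels in the
    ratio of square roots, so only unnormalised sums remain.\<close>
  have high: "p k = s * (1 / sqrt (partial_sum w k))" if "k \<in> {m * j + 1..?N}" for k
  proof -
    have "p k = (sqrt (right_end m n w (m * j)) - sqrt (right_end m n w a)) / sqrt (right_end m n w k)"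
      unfolding p_def a_def[symmetric]
    proof (rule measure_left_density_Ioc)
      show "0 < right_end m n w k" by (rule right_end_pos) (use w that in auto)
      show "0 \<le> right_end m n w a" unfolding right_end_def using a0 T by simp
      show "right_end m n w a \<le> right_end m n w (m * j)" by (rule right_end_mono) (use w ord in auto)
      show "right_end m n w (m * j) \<le> right_end m n w k" by (rule right_end_mono) (use w that in auto)
    qed
    then show ?thesis
      unfolding s_def right_end_def using T by (simp add: real_sqrt_divide diff_divide_distrib[symmetric])
  qed
  have split: "{1..?N} = {1..a} \<union> ({a+1..m * j} \<union> {m * j + 1..?N})" using ord by auto
  have "(\<Sum>k=1..?N. p k) = (\<Sum>k=1..a. p k) + ((\<Sum>k=a+1..m * j. p k) + (\<Sum>k=m * j + 1..?N. p k))"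
    unfolding split using ord by (subst sum.union_disjoint; (subst sum.union_disjoint)?; auto)
  also have "(\<Sum>k=1..a. p k) = 0" using low by (intro sum.neutral) blast
  also have "(\<Sum>k=m * j + 1..?N. p k) = s * (\<Sum>k=m * j + 1..?N. 1 / sqrt (partial_sum w k))"
    unfolding sum_distrib_left using high by (intro sum.cong) auto
  finally have \<mu>: "(\<Sum>k=1..?N. p k) = (\<Sum>k=a+1..m * j. p k)
      + s * (\<Sum>k=m * j + 1..?N. 1 / sqrt (partial_sum w k))" by simp
  have "0 \<le> (\<Sum>k=a+1..m * j. p k)" using mid by (intro sum_nonneg) blast
  moreover have "(\<Sum>k=a+1..m * j. p k) \<le> (\<Sum>k=a+1..m * j. 1)" using mid by (intro sum_mono) blast
  ultimately have midsum: "\<bar>\<Sum>k=a+1..m * j. p k\<bar> \<le> real m" using ord by simp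
  let ?S = "\<Sum>k=m * j + 1..?N. 1 / sqrt (partial_sum w k)"
  let ?E = "\<Sum>k=2..?N. \<bar>1 / sqrt (partial_sum w k) - 1 / sqrt (real k)\<bar>"
  have "\<bar>?S - (\<Sum>k=m * j + 1..?N. 1 / sqrt (real k))\<bar>
      \<le> (\<Sum>k=m * j + 1..?N. \<bar>1 / sqrt (partial_sum w k) - 1 / sqrt (real k)\<bar>)"
    unfolding sum_subtractf[symmetric] by (rule sum_abs)
  \<comment> \<open>As \<open>m * j\<close> is at least \<open>1\<close>, the range starting at
    \<open>m * j + 1\<close> lies inside the one starting at \<open>2\<close>.\<close>
  also have "\<dots> \<le> ?E" using ord by (intro sum_mono2) auto
  finally have "\<bar>?S - 2 * sqrt (real ?N)\<bar> \<le> ?E + 2 * sqrt (real (m * j + 1))"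
    using sum_inverse_sqrt_bound[OF ord(2)] by linarith
  then have "s * \<bar>?S - 2 * sqrt (real ?N)\<bar> \<le> s * (?E + 2 * sqrt (real (m * j + 1)))"
    using s0 by (rule mult_left_mono)
  moreover have "approx_degree m n (w, l) j = s * (2 * sqrt (real ?N))"
    unfolding approx_degree_def s_def a_def by simp
  then have "(\<Sum>k=1..?N. p k) - approx_degree m n (w, l) j
      = (\<Sum>k=a+1..m * j. p k) + s * (?S - 2 * sqrt (real ?N))"
    using \<mu> by (simp add: right_diff_distrib)
  ultimately show ?thesis
    using midsum s0 abs_triangle_ineq[of "\<Sum>k=a+1..m * j. p k" "s * (?S - 2 * sqrt (real ?N))"]
    unfolding s_def[symmetric] a_def[symmetric] by (simp only: abs_mult abs_of_nonneg)
qed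

section \<open>Sign and measurability of the degree approximation\<close>

lemma partial_sum_block_le:
  assumes w: "\<And>i. i \<in> {1..m * n + 1} \<Longrightarrow> 0 < w i" and j: "j \<le> n"
  shows "partial_sum w (m * (j - 1)) \<le> partial_sum w (m * j)"
proof (rule partial_sum_le)
  show "m * (j - 1) \<le> m * j" by (rule mult_le_mono2) simp
  show "m * j \<le> m * n + 1" using mult_le_mono2[OF j, of m] by linarith
qed (rule w)

lemma approx_degree_nonneg:
  assumes w: "\<And>i. i \<in> {1..m * n + 1} \<Longrightarrow> 0 < w i" and j: "j \<le> n"
  shows "0 \<le> approx_degree m n (w, l) j"
  using partial_sum_block_le[OF _ j, of m w] w by (simp add: approx_degree_def)

lemma approx_degree_measurable:
  assumes "j \<le> n"
  shows "(\<lambda>w. approx_degree m n (w, l) j) \<in> borel_measurable (exp_law m n)"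
proof -
  have "m * (j - 1) \<le> m * n + 1" "m * j \<le> m * n + 1"
    using mult_le_mono2[of "j - 1" n m] mult_le_mono2[of j n m] assms by linarith+
  note [measurable] = this[THEN partial_sum_measurable]
  show ?thesis
    unfolding approx_degree_def fst_conv by measurable
qed

lemma approx_degree_measurable_attach:
  assumes "j \<le> n"
  shows "(\<lambda>\<omega>. approx_degree m n \<omega> j) \<in> borel_measurable (attach_law m n)"
proof -
  \<comment> \<open>\<open>approx_degree\<close> depends on the exponential variables only, so any
    fixed second component serves.\<close>
  have "(\<lambda>w. approx_degree m n (w, undefined) j) \<in> borel_measurable (PiM {1..m * n + 1} (\<lambda>_. borel))"
    using approx_degree_measurable[OF assms] unfolding measurable_cong_sets[OF sets_exp_law refl] .
  from measurable_compose[OF measurable_fst this]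
  show ?thesis
    unfolding measurable_cong_sets[OF sets_attach_law refl] by (simp add: approx_degree_def)
qed

lemma attach_degree_real_measurable:
  "(\<lambda>\<omega>. real (attach_degree m n \<omega> j)) \<in> borel_measurable (attach_law m n)"
  by (rule measurable_compose[OF attach_degree_measurable]) simp

lemma degree_deviation_measurable:
  assumes "J \<le> n"
  shows "{\<omega> \<in> space (attach_law m n). \<forall>j\<in>{1..J}.
      \<bar>real (attach_degree m n \<omega> j) - approx_degree m n \<omega> j\<bar> \<le> C * approx_degree m n \<omega> j}
    \<in> sets (attach_law m n)"
  using assms
  by (intro sets.sets_Collect_finite_All borel_measurable_le borel_measurable_abs borel_measurable_diff
      borel_measurable_times borel_measurable_const attach_degree_real_measurable
      approx_degree_measurable_attach) auto

text \<open>The deterministic hypotheses on \<open>w\<close> turn every error into a multiple of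
  \<open>\<tau>\<close> times the approximate degree: \<open>E\<close> controls the conditional
  mean, and \<open>L\<close> makes both the additive Chernoff term \<open>c / \<tau>\<close> and the
  constant \<open>m\<close> relatively small. A union bound over \<open>j\<close> gives the failure
  probability.\<close>

lemma left_law_degree_deviation:
  fixes \<tau> c K :: real and J :: nat
  assumes w: "\<And>i. i \<in> {1..m * n + 1} \<Longrightarrow> 0 < w i" and m: "1 \<le> m" and J: "J \<le> n"
    and \<tau>: "0 < \<tau>" "\<tau> \<le> 1" and c: "1 \<le> c"
    and E: "(\<Sum>k=2..m * n. \<bar>1 / sqrt (partial_sum w k) - 1 / sqrt (real k)\<bar>)
      + 2 * sqrt (real (m * J + 1)) \<le> K * \<tau> * sqrt (real n)"
    and L: "\<And>j l. j \<in> {1..J} \<Longrightarrow> c / (2 * \<tau>\<^sup>2) \<le> approx_degree m n (w, l) j"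
    and wsp: "w \<in> space (exp_law m n)"
  defines "A \<equiv> {\<omega> \<in> space (attach_law m n). \<forall>j\<in>{1..J}.
    \<bar>real (attach_degree m n \<omega> j) - approx_degree m n \<omega> j\<bar> \<le> (3 + 6 * real m + 2 * K) * \<tau> * approx_degree m n \<omega> j}"
  shows "1 - 2 * real J * exp (- c) \<le> measure (left_law m n w) {l \<in> space (left_law m n w). (w, l) \<in> A}"
proof -
  let ?N = "m * n"
  let ?W = "PiM {1..m * n + 1} (\<lambda>_. borel) :: (nat \<Rightarrow> real) measure"
  let ?L = "PiM {1..m * n} (\<lambda>_. borel) :: (nat \<Rightarrow> real) measure"
  define I where "I j = {right_end m n w (m * (j - 1)) <.. right_end m n w (m * j)}" for j
  define p where "p j k = measure (density lborel (\<lambda>x. ennreal (left_density (right_end m n w k) x))) (I j)" for j k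
  define \<mu> where "\<mu> j = (\<Sum>k=1..?N. p j k)" for j
  define S :: "nat \<Rightarrow> (nat \<Rightarrow> real) \<Rightarrow> real" where "S j l = (\<Sum>k=1..?N. indicator (I j) (l k))" for j l
  define B where "B j = {l \<in> space (left_law m n w). \<tau> * \<mu> j + c / \<tau> \<le> \<bar>S j l - \<mu> j\<bar>}" for j
  interpret P: prob_space "left_law m n w" by (rule prob_space_left_law) (rule w)
  \<comment> \<open>Forced by \<open>E\<close>, whose left-hand side is positive.\<close>
  have K: "0 \<le> K"
  proof (rule ccontr)
    assume "\<not> 0 \<le> K"
    then have "K * \<tau> * sqrt (real n) \<le> 0" using \<tau> by (intro mult_nonpos_nonneg) (auto simp: mult_nonpos_nonneg)
    moreover have "0 \<le> (\<Sum>k=2..m * n. \<bar>1 / sqrt (partial_sum w k) - 1 / sqrt (real k)\<bar>)"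
      by (rule sum_nonneg) simp
    moreover have "0 < sqrt (real (m * J + 1))" by (subst real_sqrt_gt_0_iff) (simp only: of_nat_0_less_iff)
    ultimately show False using E by linarith
  qed
  have Bm: "B j \<in> sets (left_law m n w)" for j
  proof -
    have [measurable]: "S j \<in> borel_measurable (left_law m n w)"
      unfolding S_def
    proof (rule borel_measurable_sum)
      fix k assume k: "k \<in> {1..?N}"
      show "(\<lambda>l. indicator (I j) (l k) :: real) \<in> borel_measurable (left_law m n w)"
        unfolding measurable_cong_sets[OF sets_left_law refl]
        by (rule measurable_compose[OF measurable_component_singleton[OF k]])
          (rule borel_measurable_indicator, simp add: I_def)
    qed
    show ?thesis unfolding B_def by measurable
  qed
  have Bp: "measure (left_law m n w) (B j) \<le> 2 * exp (- c)" for j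
    unfolding B_def S_def \<mu>_def p_def left_law_def
    by (rule prob_sum_indicator_deviation[OF product_sigma_finite_left_density])
      (use w \<tau> in \<open>auto simp: I_def intro!: prob_space_left_density right_end_pos\<close>)
  have good: "\<bar>real (attach_degree m n (w, l) j) - approx_degree m n (w, l) j\<bar>
      \<le> (3 + 6 * real m + 2 * K) * \<tau> * approx_degree m n (w, l) j"
    if l: "\<And>k. k \<in> {1..?N} \<Longrightarrow> 0 < l k \<and> l k \<le> right_end m n w k"
      and j: "j \<in> {1..J}" and lB: "\<not> \<tau> * \<mu> j + c / \<tau> \<le> \<bar>S j l - \<mu> j\<bar>" for l j
  proof -
    let ?D = "approx_degree m n (w, l) j"
    have jn: "j \<in> {1..n}" using j J by auto
    have deg: "real (attach_degree m n (w, l) j) = real m + S j l"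
      unfolding S_def I_def by (rule attach_degree_eq_count) (use w jn l in auto)
    have D0: "0 \<le> ?D" by (rule approx_degree_nonneg) (use w jn in auto)
    have c\<tau>: "c \<le> 2 * \<tau>\<^sup>2 * ?D" using L[OF j, of l] \<tau> by (simp add: field_simps)
    then have "c / \<tau> \<le> 2 * \<tau>\<^sup>2 * ?D / \<tau>" using \<tau> by (intro divide_right_mono) auto
    then have c1: "c / \<tau> \<le> 2 * (\<tau> * ?D)" using \<tau> by (simp add: power2_eq_square)
    \<comment> \<open>This lets the additive constant \<open>m\<close> be absorbed:
      \<open>m \<le> m * (c / \<tau>) \<le> 2 * m * (\<tau> * ?D)\<close>.\<close>
    have "1 \<le> c / \<tau>" using c \<tau> by simp
    then have "real m * 1 \<le> real m * (2 * (\<tau> * ?D))" using c1 by (intro mult_left_mono) auto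
    then have m1: "real m \<le> 2 * real m * (\<tau> * ?D)" by simp
    define s where "s = sqrt (partial_sum w (m * j)) - sqrt (partial_sum w (m * (j - 1)))"
    have D: "?D = 2 * sqrt (real ?N) * s" by (simp add: approx_degree_def s_def)
    have s0: "0 \<le> s"
      using partial_sum_block_le[of m n w j] w jn by (simp add: s_def)
    have "\<bar>\<mu> j - ?D\<bar> \<le> real m + s * ((\<Sum>k=2..m * n. \<bar>1 / sqrt (partial_sum w k) - 1 / sqrt (real k)\<bar>)
        + 2 * sqrt (real (m * j + 1)))"
      unfolding \<mu>_def p_def I_def s_def by (rule conditional_mean_approx) (use w m jn in auto)
    also have "\<dots> \<le> real m + s * (K * \<tau> * sqrt (real n))"
    proof -
      have "sqrt (real (m * j + 1)) \<le> sqrt (real (m * J + 1))"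
        using mult_le_mono2[of j J m] j by (subst real_sqrt_le_iff) (simp del: of_nat_mult of_nat_add of_nat_Suc)
      then show ?thesis using E s0 by (intro add_left_mono mult_left_mono) linarith+
    qed
    also have "s * (K * \<tau> * sqrt (real n)) \<le> s * (K * \<tau> * sqrt (real ?N))"
    proof -
      have "n \<le> ?N" using mult_le_mono1[OF m, of n] by simp
      then have "sqrt (real n) \<le> sqrt (real ?N)" by (simp only: real_sqrt_le_iff of_nat_le_iff)
      then show ?thesis using s0 K \<tau> by (intro mult_left_mono) auto
    qed
    also have "\<dots> \<le> K * (\<tau> * ?D)" using D s0 K \<tau> by (simp add: mult_ac)
    finally have "\<bar>\<mu> j - ?D\<bar> \<le> real m + K * (\<tau> * ?D)" by simp
    then have \<mu>D: "\<bar>\<mu> j - ?D\<bar> \<le> 2 * real m * (\<tau> * ?D) + K * (\<tau> * ?D)" using m1 by linarith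
    \<comment> \<open>A crude bound of \<open>\<mu> j\<close> by a constant multiple of
      \<open>?D\<close> is enough, because it is multiplied by \<open>\<tau>\<close> again.\<close>
    have t1: "\<tau> * ?D \<le> ?D" using \<tau> D0 by (simp add: mult_left_le_one_le)
    have "2 * real m * (\<tau> * ?D) \<le> 2 * real m * ?D" "K * (\<tau> * ?D) \<le> K * ?D"
      using t1 K by (intro mult_left_mono; simp)+
    with \<mu>D have "\<mu> j \<le> ?D + 2 * real m * ?D + K * ?D" by linarith
    then have "\<tau> * \<mu> j \<le> \<tau> * (?D + 2 * real m * ?D + K * ?D)" using \<tau> by (intro mult_left_mono) auto
    also have "\<dots> = \<tau> * ?D + 2 * real m * (\<tau> * ?D) + K * (\<tau> * ?D)" by (simp add: algebra_simps)
    finally have t\<mu>: "\<tau> * \<mu> j \<le> \<tau> * ?D + 2 * real m * (\<tau> * ?D) + K * (\<tau> * ?D)" .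
    have "\<bar>real m + S j l - ?D\<bar> \<le> real m + \<bar>S j l - \<mu> j\<bar> + \<bar>\<mu> j - ?D\<bar>" by linarith
    \<comment> \<open>In units of \<open>\<tau> * ?D\<close>: the constant \<open>m\<close> costs
      \<open>2 * m\<close>, the Chernoff deviation \<open>1 + 2 * m + K\<close> plus
      \<open>2\<close> for \<open>c / \<tau>\<close>, and the error of the mean
      \<open>2 * m + K\<close>.\<close>
    also have "\<dots> \<le> 3 * (\<tau> * ?D) + 6 * real m * (\<tau> * ?D) + 2 * K * (\<tau> * ?D)"
      using lB t\<mu> \<mu>D m1 c1 by linarith
    finally show ?thesis unfolding deg by (simp add: algebra_simps)
  qed
  have "w \<in> space ?W" using wsp sets_eq_imp_space_eq[OF sets_exp_law[of m n]] by simp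
  then have "(\<lambda>l. (w, l)) \<in> measurable (left_law m n w) (?W \<Otimes>\<^sub>M ?L)" by measurable
  then have pm: "(\<lambda>l. (w, l)) \<in> measurable (left_law m n w) (attach_law m n)"
    unfolding measurable_cong_sets[OF refl sets_attach_law] .
  have ae: "AE l in left_law m n w. \<forall>k\<in>{1..?N}. 0 < l k \<and> l k \<le> right_end m n w k"
    by (rule AE_left_law_le_right_end) (rule w)
  have "measure (left_law m n w) {l \<in> space (left_law m n w). (w, l) \<notin> A}
      \<le> measure (left_law m n w) (\<Union>j\<in>{1..J}. B j)"
  proof (rule P.finite_measure_mono_AE)
    show "AE l in left_law m n w. l \<in> {l \<in> space (left_law m n w). (w, l) \<notin> A} \<longrightarrow> l \<in> (\<Union>j\<in>{1..J}. B j)"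
      using ae
    proof eventually_elim
      case (elim l)
      show ?case
      proof
        assume l: "l \<in> {l \<in> space (left_law m n w). (w, l) \<notin> A}"
        then have "(w, l) \<in> space (attach_law m n)" using measurable_space[OF pm] by blast
        with l obtain j where j: "j \<in> {1..J}" and
          "\<not> \<bar>real (attach_degree m n (w, l) j) - approx_degree m n (w, l) j\<bar>
            \<le> (3 + 6 * real m + 2 * K) * \<tau> * approx_degree m n (w, l) j"
          unfolding A_def by blast
        with good[of l j] elim have "\<tau> * \<mu> j + c / \<tau> \<le> \<bar>S j l - \<mu> j\<bar>" by blast
        then have "l \<in> B j" using l by (simp add: B_def)
        then show "l \<in> (\<Union>j\<in>{1..J}. B j)" using j by blast
      qed
    qed
    show "(\<Union>j\<in>{1..J}. B j) \<in> sets (left_law m n w)" using Bm by auto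
  qed
  also have "\<dots> \<le> (\<Sum>j\<in>{1..J}. measure (left_law m n w) (B j))"
    using Bm by (intro measure_UNION_le) auto
  also have "\<dots> \<le> (\<Sum>j\<in>{1..J}. 2 * exp (- c))" using Bp by (intro sum_mono)
  also have "\<dots> = 2 * real J * exp (- c)" by simp
  finally have compl: "measure (left_law m n w) {l \<in> space (left_law m n w). (w, l) \<notin> A} \<le> 2 * real J * exp (- c)" .
  have "A \<in> sets (attach_law m n)"
    unfolding A_def using J by (rule degree_deviation_measurable)
  with pm have "(\<lambda>l. (w, l)) -` A \<inter> space (left_law m n w) \<in> sets (left_law m n w)"
    by (rule measurable_sets)
  also have "(\<lambda>l. (w, l)) -` A \<inter> space (left_law m n w) = {l \<in> space (left_law m n w). (w, l) \<in> A}" by auto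
  finally have "measure (left_law m n w) (space (left_law m n w) - {l \<in> space (left_law m n w). (w, l) \<in> A})
      = 1 - measure (left_law m n w) {l \<in> space (left_law m n w). (w, l) \<in> A}"
    by (rule P.prob_compl)
  also have "space (left_law m n w) - {l \<in> space (left_law m n w). (w, l) \<in> A}
      = {l \<in> space (left_law m n w). (w, l) \<notin> A}" by auto
  finally show ?thesis using compl by linarith
qed

subsection \<open>Exceptional exponential variables\<close>

lemma exp_law_partial_sum_distributed:
  assumes "1 \<le> k" "k \<le> m * n + 1"
  shows "distributed (exp_law m n) lborel (\<lambda>w. partial_sum w k) (erlang_density (k - 1) 1)"
  using exp_law_sum_distributed[of "{1..k}" m n] assms by (simp add: partial_sum_def[abs_def])

text \<open>Markov's inequality; the mean errors \<open>3 / (2 * k)\<close> add up to a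
  logarithm.\<close>

lemma prob_sum_inverse_sqrt_ge:
  fixes x :: real
  assumes x: "0 < x" and N: "1 \<le> m * n"
  shows "\<P>(w in exp_law m n. x \<le> (\<Sum>k=2..m * n. \<bar>1 / sqrt (partial_sum w k) - 1 / sqrt (real k)\<bar>))
    \<le> 3 / 2 * ln (real (m * n)) / x"
proof -
  interpret prob_space "exp_law m n" by (rule prob_space_exp_law)
  let ?f = "\<lambda>k w. \<bar>1 / sqrt (partial_sum w k) - 1 / sqrt (real k)\<bar>"
  have f: "integrable (exp_law m n) (?f k)" "expectation (?f k) \<le> 3 / 2 * (1 / real k)"
    if k: "k \<in> {2..m * n}" for k
  proof -
    have "distributed (exp_law m n) lborel (\<lambda>w. partial_sum w k) (erlang_density (k - 1) 1)"
      using k by (intro exp_law_partial_sum_distributed) auto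
    from erlang_expectation_inverse_sqrt[OF this] k
    show "integrable (exp_law m n) (?f k)" "expectation (?f k) \<le> 3 / 2 * (1 / real k)" by auto
  qed
  have "\<P>(w in exp_law m n. x \<le> (\<Sum>k=2..m * n. ?f k w)) \<le> expectation (\<lambda>w. \<Sum>k=2..m * n. ?f k w) / x"
    using f(1) x
    by (intro integral_Markov_inequality_measure[OF _ sets.top] Bochner_Integration.integrable_sum)
      (auto intro!: sum_nonneg)
  also have "expectation (\<lambda>w. \<Sum>k=2..m * n. ?f k w) = (\<Sum>k=2..m * n. expectation (?f k))"
    using f(1) by (rule Bochner_Integration.integral_sum)
  also have "(\<Sum>k=2..m * n. expectation (?f k)) / x \<le> (\<Sum>k=2..m * n. 3 / 2 * (1 / real k)) / x"
    using f(2) x by (intro divide_right_mono sum_mono) auto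
  also have "\<dots> = 3 / 2 * (\<Sum>k=2..m * n. 1 / real k) / x"
    by (simp only: sum_distrib_left)
  also have "\<dots> \<le> 3 / 2 * ln (real (m * n)) / x"
    using sum_inverse_le_ln[OF N] x by (intro divide_right_mono mult_left_mono) auto
  finally show ?thesis .
qed

text \<open>A small value of \<open>approx_degree\<close> forces either an unusually large sum of
  the first \<open>m * J\<close> variables or an unusually small block sum. The first event is a
  single upper tail; the second is a union over \<open>J\<close> blocks of Erlang small-ball
  events.\<close>

lemma prob_approx_degree_less:
  fixes L :: real
  assumes m: "1 \<le> m" and J: "1 \<le> J" "J \<le> n" and L: "0 \<le> L"
  shows "\<P>(w in exp_law m n. \<exists>j\<in>{1..J}. approx_degree m n (w, l) j < L)
    \<le> exp (- real (m * J)) + real J * (2 * L * sqrt (real J) / sqrt (real n)) ^ m"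
proof -
  interpret prob_space "exp_law m n" by (rule prob_space_exp_law)
  \<comment> \<open>The block-sum threshold implied by \<open>L\<close> when the first
    \<open>m * J\<close> variables sum to at most \<open>4 * m * J\<close>; the factors
    \<open>sqrt m\<close> cancel.\<close>
  define y where "y = 2 * L * sqrt (real J) / sqrt (real n)"
  have y: "0 \<le> y" using L by (simp add: y_def)
  have ms: "(\<lambda>w. partial_sum w k) \<in> borel_measurable (exp_law m n)" if "k \<le> m * n + 1" for k
    unfolding measurable_cong_sets[OF sets_exp_law refl] using that by measurable
  let ?g = "\<lambda>j w. \<Sum>i\<in>{m * (j - 1) + 1..m * j}. w i"
  have mJ: "m * J \<le> m * n" "1 \<le> m * J" using J m by (auto simp: Suc_le_eq)
  have mJ1: "m * J \<le> m * n + 1" using mJ(1) by linarith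
  have blk: "m * j \<le> m * J" "m * (j - 1) + m = m * j" "m * j \<le> m * n + 1" if "j \<in> {1..J}" for j
  proof -
    show "m * j \<le> m * J" using that by (intro mult_le_mono2) auto
    then show "m * j \<le> m * n + 1" using mJ(1) by linarith
    show "m * (j - 1) + m = m * j" using that by (cases j) auto
  qed
  have g: "distributed (exp_law m n) lborel (?g j) (erlang_density (m - 1) 1)" if j: "j \<in> {1..J}" for j
  proof -
    have "card {m * (j - 1) + 1..m * j} = m" using blk[OF j] by simp
    moreover have "{m * (j - 1) + 1..m * j} \<subseteq> {1..m * n + 1}" using blk(3)[OF j] by auto
    moreover have "{m * (j - 1) + 1..m * j} \<noteq> {}" using blk(2)[OF j] m by auto
    ultimately show ?thesis using exp_law_sum_distributed[of "{m * (j - 1) + 1..m * j}" m n] by simp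
  qed
  have gm: "?g j \<in> borel_measurable (exp_law m n)" if "j \<in> {1..J}" for j
    using distributed_measurable[OF g[OF that]] by simp
  define B0 where "B0 = {w \<in> space (exp_law m n). 4 * real (m * J) < partial_sum w (m * J)}"
  define B where "B j = {w \<in> space (exp_law m n). ?g j w \<le> y}" for j
  have B0s: "B0 \<in> sets (exp_law m n)"
    unfolding B0_def using ms[OF mJ1] by measurable
  have Bs: "B j \<in> sets (exp_law m n)" if "j \<in> {1..J}" for j
    unfolding B_def using gm[OF that] by measurable
  have pB0: "prob B0 \<le> exp (- real (m * J))"
    using prob_erlang_gt_le_exp[OF exp_law_partial_sum_distributed[of "m * J" m n]] mJ
    by (simp add: B0_def del: of_nat_mult)
  have pB: "prob (B j) \<le> y ^ m" if "j \<in> {1..J}" for j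
    using prob_erlang_le_power[OF g[OF that] y] m by (simp add: B_def)
  have small: "?g j w \<le> y"
    if w: "\<And>i. i \<in> {1..m * n + 1} \<Longrightarrow> 0 < w i" and W: "partial_sum w (m * J) \<le> 4 * real (m * J)"
      and j: "j \<in> {1..J}" and less: "approx_degree m n (w, l) j < L" for w j
  proof -
    let ?u = "partial_sum w (m * j)" and ?v = "partial_sum w (m * (j - 1))"
    have "{1..m * j} = {1..m * (j - 1)} \<union> {m * (j - 1) + 1..m * j}" using blk(2)[OF j] by auto
    then have g_eq: "?u = ?v + ?g j w"
      unfolding partial_sum_def by (simp only:) (subst sum.union_disjoint, auto)
    have v0: "0 \<le> ?v"
      by (rule partial_sum_nonneg[of "m * n + 1"]) (use w blk[OF j] mJ in auto)
    have vu: "?v \<le> ?u"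
      by (rule partial_sum_le[of "m * n + 1"]) (use w blk[OF j] mJ in auto)
    have u0: "0 < ?u"
      by (rule partial_sum_pos[of "m * n + 1"]) (use w blk[OF j] mJ m j in auto)
    have uJ: "?u \<le> partial_sum w (m * J)"
      by (rule partial_sum_le[of "m * n + 1"]) (use w blk[OF j] mJ1 in auto)
    have n0: "0 < sqrt (real n)" using J by simp
    \<comment> \<open>As a difference of squares, the block sum is
      \<open>approx_degree / (2 * sqrt (m * n))\<close> times a factor of at most
      \<open>2 * sqrt (4 * m * J)\<close>.\<close>
    have "?g j w = (sqrt ?u - sqrt ?v) * (sqrt ?u + sqrt ?v)"
      using g_eq v0 u0 by (simp add: algebra_simps)
    also have "\<dots> \<le> (sqrt ?u - sqrt ?v) * (2 * sqrt (4 * real (m * J)))"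
    proof (rule mult_left_mono)
      have "sqrt ?u \<le> sqrt (4 * real (m * J))" "sqrt ?v \<le> sqrt ?u"
        using uJ W vu by (intro real_sqrt_le_mono; linarith)+
      then show "sqrt ?u + sqrt ?v \<le> 2 * sqrt (4 * real (m * J))" by linarith
    qed (use vu in simp)
    also have "\<dots> = approx_degree m n (w, l) j * (2 * sqrt (real J) / sqrt (real n))"
      using n0 m by (simp add: approx_degree_def real_sqrt_mult)
    also have "\<dots> \<le> L * (2 * sqrt (real J) / sqrt (real n))"
      using less by (intro mult_right_mono) auto
    also have "\<dots> = y" by (simp add: y_def)
    finally show ?thesis .
  qed
  have "\<P>(w in exp_law m n. \<exists>j\<in>{1..J}. approx_degree m n (w, l) j < L) \<le> prob (B0 \<union> (\<Union>j\<in>{1..J}. B j))"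
  proof (rule finite_measure_mono_AE)
    show "AE w in exp_law m n. w \<in> {w \<in> space (exp_law m n). \<exists>j\<in>{1..J}. approx_degree m n (w, l) j < L}
        \<longrightarrow> w \<in> B0 \<union> (\<Union>j\<in>{1..J}. B j)"
      using AE_exp_law_pos
    proof eventually_elim
      case (elim w)
      show ?case
      proof (intro impI, rule ccontr)
        assume w: "w \<in> {w \<in> space (exp_law m n). \<exists>j\<in>{1..J}. approx_degree m n (w, l) j < L}"
          and not: "w \<notin> B0 \<union> (\<Union>j\<in>{1..J}. B j)"
        then obtain j where j: "j \<in> {1..J}" "approx_degree m n (w, l) j < L" by blast
        have "\<not> 4 * real (m * J) < partial_sum w (m * J)" using w not unfolding B0_def by blast
        then have "partial_sum w (m * J) \<le> 4 * real (m * J)" by (rule leI)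
        then have "?g j w \<le> y" using elim j by (intro small) blast+
        then show False using w not j(1) unfolding B_def by blast
      qed
    qed
  qed (use B0s Bs in auto)
  also have "\<dots> \<le> prob B0 + prob (\<Union>j\<in>{1..J}. B j)" using B0s Bs by (intro measure_Un_le) auto
  also have "prob (\<Union>j\<in>{1..J}. B j) \<le> (\<Sum>j\<in>{1..J}. prob (B j))" using Bs by (intro measure_UNION_le) auto
  also have "\<dots> \<le> (\<Sum>j\<in>{1..J}. y ^ m)" using pB by (rule sum_mono)
  finally show ?thesis using pB0 by (simp add: y_def)
qed

text \<open>The four failure terms come, in order, from a large error sum, a large sum of the first
  \<open>m * J\<close> variables, a small block, and the conditional Chernoff bounds.\<close>

lemma prob_attach_law_degree_approx:
  fixes \<tau> c x K :: real
  assumes m: "1 \<le> m" and J: "1 \<le> J" "J \<le> n"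
    and \<tau>: "0 < \<tau>" "\<tau> \<le> 1" and c: "1 \<le> c" and x: "0 < x"
    and K: "x + 2 * sqrt (real (m * J + 1)) \<le> K * \<tau> * sqrt (real n)"
  shows "\<P>(\<omega> in attach_law m n. \<forall>j\<in>{1..J}.
      \<bar>real (attach_degree m n \<omega> j) - approx_degree m n \<omega> j\<bar>
        \<le> (3 + 6 * real m + 2 * K) * \<tau> * approx_degree m n \<omega> j)
    \<ge> 1 - (3 / 2 * ln (real (m * n)) / x + exp (- real (m * J))
      + real J * (c / \<tau>\<^sup>2 * sqrt (real J) / sqrt (real n)) ^ m + 2 * real J * exp (- c))"
proof -
  interpret E: prob_space "exp_law m n" by (rule prob_space_exp_law)
  let ?E = "\<lambda>w. \<Sum>k=2..m * n. \<bar>1 / sqrt (partial_sum w k) - 1 / sqrt (real k)\<bar>"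
  \<comment> \<open>The least approximate degree for which the additive Chernoff error
    \<open>c / \<tau>\<close> is at most \<open>2 * \<tau>\<close> times that degree.\<close>
  define L where "L = c / (2 * \<tau>\<^sup>2)"
  have L: "0 \<le> L" "2 * L = c / \<tau>\<^sup>2" using c by (auto simp: L_def)
  define B1 where "B1 = {w \<in> space (exp_law m n). x \<le> ?E w}"
  define B2 where "B2 = {w \<in> space (exp_law m n). \<exists>j\<in>{1..J}. approx_degree m n (w, undefined) j < L}"
  have [measurable]: "?E \<in> borel_measurable (exp_law m n)"
  proof (rule borel_measurable_sum)
    fix k assume "k \<in> {2..m * n}"
    then have "k \<le> m * n + 1" by simp
    note [measurable] = partial_sum_measurable[OF this]
    show "(\<lambda>w. \<bar>1 / sqrt (partial_sum w k) - 1 / sqrt (real k)\<bar>) \<in> borel_measurable (exp_law m n)"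
      by measurable
  qed
  have B1s: "B1 \<in> sets (exp_law m n)" unfolding B1_def by measurable
  have B2s: "B2 \<in> sets (exp_law m n)"
    unfolding B2_def using J
    by (intro sets.sets_Collect_finite_Ex borel_measurable_less approx_degree_measurable) auto
  have "E.prob B1 \<le> 3 / 2 * ln (real (m * n)) / x"
    unfolding B1_def using x by (rule prob_sum_inverse_sqrt_ge) (use m J in \<open>auto simp: Suc_le_eq\<close>)
  moreover have "E.prob B2 \<le> exp (- real (m * J)) + real J * (c / \<tau>\<^sup>2 * sqrt (real J) / sqrt (real n)) ^ m"
    unfolding B2_def L(2)[symmetric] using m J L(1) by (rule prob_approx_degree_less)
  moreover have "E.prob (B1 \<union> B2) \<le> E.prob B1 + E.prob B2"
    using B1s B2s by (rule measure_Un_le)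
  moreover have "E.prob (space (exp_law m n) - (B1 \<union> B2)) = 1 - E.prob (B1 \<union> B2)"
    using B1s B2s by (intro E.prob_compl) auto
  moreover have "E.prob (space (exp_law m n) - (B1 \<union> B2)) - 2 * real J * exp (- c)
    \<le> \<P>(\<omega> in attach_law m n. \<forall>j\<in>{1..J}.
      \<bar>real (attach_degree m n \<omega> j) - approx_degree m n \<omega> j\<bar>
        \<le> (3 + 6 * real m + 2 * K) * \<tau> * approx_degree m n \<omega> j)"
  proof (rule measure_attach_law_ge)
    show "{\<omega> \<in> space (attach_law m n). \<forall>j\<in>{1..J}.
      \<bar>real (attach_degree m n \<omega> j) - approx_degree m n \<omega> j\<bar>
        \<le> (3 + 6 * real m + 2 * K) * \<tau> * approx_degree m n \<omega> j} \<in> sets (attach_law m n)"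
      using J(2) by (rule degree_deviation_measurable)
    show "space (exp_law m n) - (B1 \<union> B2) \<in> sets (exp_law m n)"
      using B1s B2s by auto
    fix w assume w: "w \<in> space (exp_law m n) - (B1 \<union> B2)"
      and pos: "\<And>i. i \<in> {1..m * n + 1} \<Longrightarrow> 0 < w i"
    show "1 - 2 * real J * exp (- c) \<le> measure (left_law m n w) {l \<in> space (left_law m n w).
      (w, l) \<in> {\<omega> \<in> space (attach_law m n). \<forall>j\<in>{1..J}.
      \<bar>real (attach_degree m n \<omega> j) - approx_degree m n \<omega> j\<bar>
        \<le> (3 + 6 * real m + 2 * K) * \<tau> * approx_degree m n \<omega> j}}"
    proof (rule left_law_degree_deviation)
      show "0 < w i" if "i \<in> {1..m * n + 1}" for i using that by (rule pos)
      show "?E w + 2 * sqrt (real (m * J + 1)) \<le> K * \<tau> * sqrt (real n)"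
        using w K unfolding B1_def by (simp only: Diff_iff Un_iff mem_Collect_eq not_le de_Morgan_disj) linarith
      show "c / (2 * \<tau>\<^sup>2) \<le> approx_degree m n (w, l) j" if "j \<in> {1..J}" for j l
      proof -
        have "approx_degree m n (w, l) j = approx_degree m n (w, undefined) j"
          by (simp add: approx_degree_def)
        then show ?thesis
          using w that unfolding B2_def L_def[symmetric] by (auto simp: not_less simp del: One_nat_def)
      qed
      show "w \<in> space (exp_law m n)" using w by blast
    qed (use m J \<tau> c in auto)
  qed simp
  ultimately show ?thesis by linarith
qed

text \<open>The event involves \<open>w\<close> alone, so each section is empty or everything and
  the transfer to the joint law costs nothing (\<open>q = 0\<close>).\<close>

lemma prob_attach_law_approx_degree_ge:
  fixes L :: real
  assumes m: "1 \<le> m" and J: "1 \<le> J" "J \<le> n" and L: "0 \<le> L"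
  shows "\<P>(\<omega> in attach_law m n. \<forall>j\<in>{1..J}. L \<le> approx_degree m n \<omega> j)
    \<ge> 1 - (exp (- real (m * J)) + real J * (2 * L * sqrt (real J) / sqrt (real n)) ^ m)"
proof -
  interpret E: prob_space "exp_law m n" by (rule prob_space_exp_law)
  define B where "B = {w \<in> space (exp_law m n). \<exists>j\<in>{1..J}. approx_degree m n (w, undefined) j < L}"
  have Bs: "B \<in> sets (exp_law m n)"
    unfolding B_def using J
    by (intro sets.sets_Collect_finite_Ex borel_measurable_less approx_degree_measurable) auto
  have "E.prob B \<le> exp (- real (m * J)) + real J * (2 * L * sqrt (real J) / sqrt (real n)) ^ m"
    unfolding B_def using m J L by (rule prob_approx_degree_less)
  moreover have "E.prob (space (exp_law m n) - B) = 1 - E.prob B"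
    using Bs by (intro E.prob_compl) auto
  moreover have "E.prob (space (exp_law m n) - B) - 0
    \<le> \<P>(\<omega> in attach_law m n. \<forall>j\<in>{1..J}. L \<le> approx_degree m n \<omega> j)"
  proof (rule measure_attach_law_ge)
    show As: "{\<omega> \<in> space (attach_law m n). \<forall>j\<in>{1..J}. L \<le> approx_degree m n \<omega> j} \<in> sets (attach_law m n)"
      using J by (intro sets.sets_Collect_finite_All borel_measurable_le borel_measurable_const
          approx_degree_measurable_attach) auto
    show "space (exp_law m n) - B \<in> sets (exp_law m n)"
      using Bs by auto
    fix w assume w: "w \<in> space (exp_law m n) - B"
      and pos: "\<And>i. i \<in> {1..m * n + 1} \<Longrightarrow> 0 < w i"
    interpret P: prob_space "left_law m n w" by (rule prob_space_left_law) (rule pos)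
    have ge: "L \<le> approx_degree m n (w, l) j" if "j \<in> {1..J}" for j l
    proof -
      have "approx_degree m n (w, l) j = approx_degree m n (w, undefined) j"
        by (simp add: approx_degree_def)
      then show ?thesis
        using w that unfolding B_def by (auto simp: not_less simp del: One_nat_def)
    qed
    have "space (attach_law m n) = space (exp_law m n) \<times> space (left_law m n w)"
      using sets_eq_imp_space_eq[OF sets_attach_law[of m n]] sets_eq_imp_space_eq[OF sets_exp_law[of m n]]
        sets_eq_imp_space_eq[OF sets_left_law[of m n w]]
      by (simp add: space_pair_measure)
    then have "{l \<in> space (left_law m n w).
        (w, l) \<in> {\<omega> \<in> space (attach_law m n). \<forall>j\<in>{1..J}. L \<le> approx_degree m n \<omega> j}} = space (left_law m n w)"
      using w ge by auto
    then show "1 - 0 \<le> measure (left_law m n w) {l \<in> space (left_law m n w).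
        (w, l) \<in> {\<omega> \<in> space (attach_law m n). \<forall>j\<in>{1..J}. L \<le> approx_degree m n \<omega> j}}"
      by (simp only: P.prob_space diff_zero order_refl)
  qed simp
  ultimately show ?thesis by linarith
qed

subsection \<open>Asymptotics\<close>

text \<open>Reduces a bound valid for all large \<open>n\<close> to a limit, in which constants and
  logarithms are absorbed by any spare power of \<open>n\<close>.\<close>

lemma eventually_le_powr_minus:
  fixes f :: "nat \<Rightarrow> real"
  assumes "(\<lambda>n. f n * real n powr \<Delta>) \<longlonglongrightarrow> 0"
  shows "\<forall>\<^sub>F n in sequentially. f n \<le> real n powr (- \<Delta>)"
proof -
  have "\<forall>\<^sub>F n in sequentially. f n * real n powr \<Delta> < 1"
    using assms by (rule order_tendstoD) simp
  then show ?thesis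
    using eventually_gt_at_top[of 0]
  proof eventually_elim
    case (elim n)
    then show ?case by (simp add: powr_minus field_simps)
  qed
qed

lemma powr_neg_tendsto_0: "s < 0 \<Longrightarrow> (\<lambda>n. real n powr s) \<longlonglongrightarrow> 0"
  by real_asymp

lemma ln_powr_neg_tendsto_0:
  "0 < c \<Longrightarrow> s < 0 \<Longrightarrow> (\<lambda>n. ln (c * real n) * real n powr s) \<longlonglongrightarrow> 0"
  by real_asymp

lemma powr_exp_powr_tendsto_0:
  "0 < e \<Longrightarrow> (\<lambda>n. real n powr p * exp (- (real n powr e))) \<longlonglongrightarrow> 0"
  by real_asymp

lemma (in prob_space) prob_ge_if_inter_subset:
  assumes "A \<in> events" "B \<in> events" "C \<in> events" "A \<inter> B \<subseteq> C"
  shows "prob A + prob B - 1 \<le> prob C"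
proof -
  have "A \<subseteq> C \<union> (space M - B)" using assms(4) sets.sets_into_space[OF assms(1)] by blast
  then have "prob A \<le> prob (C \<union> (space M - B))"
    using assms by (intro finite_measure_mono) auto
  also have "\<dots> \<le> prob C + prob (space M - B)"
    using assms by (intro measure_Un_le) auto
  finally show ?thesis using prob_compl[OF assms(2)] by linarith
qed

lemma nat_floor_powr_bounds:
  fixes n :: nat and a :: real
  assumes "1 \<le> n" "0 < a" "a \<le> 1"
  defines "J \<equiv> nat \<lfloor>real n powr a\<rfloor>"
  shows "1 \<le> J" "J \<le> n" "real J \<le> real n powr a" "real n powr a - 1 \<le> real J"
    "sqrt (real J) \<le> real n powr (a / 2)"
proof -
  have ge: "1 \<le> real n powr a" using assms by (intro ge_one_powr_ge_zero) auto
  then have fl: "1 \<le> \<lfloor>real n powr a\<rfloor>" by (simp add: le_floor_iff)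
  then show "1 \<le> J" unfolding J_def by linarith
  show J: "real J \<le> real n powr a" unfolding J_def using fl by linarith
  show "real n powr a - 1 \<le> real J" unfolding J_def using fl by linarith
  have "real n powr a \<le> real n powr 1" using assms by (intro powr_mono) auto
  then show "J \<le> n" using J assms(1) by simp
  have "sqrt (real J) \<le> sqrt (real n powr a)" using J by (rule real_sqrt_le_mono)
  also have "\<dots> = real n powr (a / 2)" by (simp add: powr_half_sqrt[symmetric] powr_powr)
  finally show "sqrt (real J) \<le> real n powr (a / 2)" .
qed

text \<open>Inserting \<open>J \<le> n powr a\<close> gives the exponent. It is used with
  \<open>\<theta> = \<epsilon> + 2 * \<delta>\<close> for the approximation and
  \<open>\<theta> = b + \<epsilon>\<close> for the minimum degree.\<close>

lemma block_probability_powr_bound: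
  fixes n m :: nat and a \<theta> :: real
  assumes n: "1 \<le> n" and a: "0 < a" "a \<le> 1"
  defines "J \<equiv> nat \<lfloor>real n powr a\<rfloor>"
  shows "real J * (real n powr \<theta> * sqrt (real J) / sqrt (real n)) ^ m
    \<le> real n powr (a + real m * (\<theta> + a / 2 - 1 / 2))"
proof -
  note J = nat_floor_powr_bounds[OF n a, folded J_def]
  have n0: "0 < real n" using n by simp
  have "real n powr \<theta> * sqrt (real J) / sqrt (real n) \<le> real n powr \<theta> * real n powr (a / 2) / real n powr (1 / 2)"
    using J(5) n0 by (simp add: powr_half_sqrt divide_right_mono mult_left_mono)
  also have "\<dots> = real n powr (\<theta> + a / 2 - 1 / 2)" by (simp add: powr_add powr_diff)
  finally have "(real n powr \<theta> * sqrt (real J) / sqrt (real n)) ^ m \<le> (real n powr (\<theta> + a / 2 - 1 / 2)) ^ m"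
    by (intro power_mono) auto
  also have "\<dots> = real n powr (real m * (\<theta> + a / 2 - 1 / 2))"
    using n0 by (simp add: powr_power mult.commute)
  finally have "real J * (real n powr \<theta> * sqrt (real J) / sqrt (real n)) ^ m
      \<le> real n powr a * real n powr (real m * (\<theta> + a / 2 - 1 / 2))"
    using J(3) by (intro mult_mono) auto
  then show ?thesis by (simp add: powr_add)
qed

text \<open>Rounding down loses at most \<open>1\<close> in the exponent, which the factor
  \<open>exp 1\<close> repays.\<close>

lemma exp_floor_powr_bound:
  fixes n m :: nat and a :: real
  assumes n: "1 \<le> n" and a: "0 < a" "a \<le> 1" and m: "1 \<le> m"
  shows "exp (- real (m * nat \<lfloor>real n powr a\<rfloor>)) \<le> exp 1 * exp (- (real n powr a))"
proof -
  have "1 * nat \<lfloor>real n powr a\<rfloor> \<le> m * nat \<lfloor>real n powr a\<rfloor>" using m by (rule mult_le_mono1)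
  then have "real (nat \<lfloor>real n powr a\<rfloor>) \<le> real (m * nat \<lfloor>real n powr a\<rfloor>)"
    by (simp only: of_nat_le_iff mult_1)
  then show ?thesis
    unfolding exp_add[symmetric] exp_le_cancel_iff using nat_floor_powr_bounds(4)[OF n a] by linarith
qed

section \<open>Choice of exponents and the two bounds for large \<open>n\<close>\<close>

locale preferential_attachment_exponents =
  fixes m :: nat and a \<delta> :: real
  assumes m: "1 \<le> m" and a: "0 < a" "a < real m / (real m + 2)"
    and \<delta>: "0 < \<delta>" "\<delta> < (1 / 4) * (1 - a * (real m + 2) / real m)"
begin

lemma a_less_1: "a < 1"
proof -
  have "real m / (real m + 2) < 1" by simp
  with a(2) show ?thesis by linarith
qed

text \<open>Follows from \<open>(m + 2) / m \<ge> 1\<close>. It ensures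
  \<open>a / 2 \<le> 1 / 2 - \<delta>\<close>, so that \<open>sqrt J\<close> is dominated by the
  permitted error \<open>n powr (1 / 2 - \<delta>)\<close>.\<close>

lemma delta_less: "\<delta> < (1 - a) / 4"
proof -
  have "a * 1 \<le> a * ((real m + 2) / real m)" using m a by (intro mult_left_mono) auto
  then show ?thesis using \<delta>(2) by simp
qed

lemma degree_approx_eventually:
  assumes \<Delta>: "\<Delta> < (1 - a) / 2 - \<delta>"
    "\<Delta> < (real m / 2) * (1 - a * (real m + 2) / real m) - 2 * real m * \<delta>"
  shows "\<exists>C. \<forall>\<^sub>F n in sequentially.
    \<P>(\<omega> in attach_law m n. \<forall>j\<in>{1..nat \<lfloor>real n powr a\<rfloor>}.
      \<bar>real (attach_degree m n \<omega> j) - approx_degree m n \<omega> j\<bar>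
        \<le> C * real n powr (- \<delta>) * approx_degree m n \<omega> j)
    \<ge> 1 - real n powr (- \<Delta>)"
proof -
  define \<rho> where "\<rho> = (real m / 2) * (1 - a * (real m + 2) / real m) - 2 * real m * \<delta>"
  have \<rho>: "\<rho> = real m / 2 - a * (real m + 2) / 2 - 2 * real m * \<delta>"
    unfolding \<rho>_def using m by (simp add: field_simps)
  \<comment> \<open>Half of the slack \<open>\<rho> - \<Delta>\<close> is spent on the Chernoff
    parameter \<open>n powr \<epsilon>\<close>; the block term then decays with the midpoint
    exponent \<open>(\<rho> + \<Delta>) / 2\<close>, still above \<open>\<Delta>\<close>.\<close>
  define \<epsilon> where "\<epsilon> = (\<rho> - \<Delta>) / (2 * real m)"
  have \<epsilon>: "0 < \<epsilon>" "real m * \<epsilon> = (\<rho> - \<Delta>) / 2" using \<Delta>(2) m by (auto simp: \<epsilon>_def \<rho>_def)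
  \<comment> \<open>The \<open>1\<close> pays for \<open>?x\<close>, the rest for
    \<open>2 * sqrt (m * J + 1)\<close>, using \<open>m * J + 1 \<le> 2 * m * J\<close>.\<close>
  define K where "K = 1 + 2 * sqrt (2 * real m)"
  define f where "f n = 3 / 2 * (ln (real m * real n) * real n powr (\<delta> - 1 / 2))
    + exp 1 * exp (- (real n powr a)) + real n powr (- (\<rho> + \<Delta>) / 2)
    + 2 * (real n powr a * exp (- (real n powr \<epsilon>)))" for n :: nat
  have lim: "(\<lambda>n. f n * real n powr \<Delta>) \<longlonglongrightarrow> 0"
  proof -
    have "\<Delta> + \<delta> - 1 / 2 < 0" using \<Delta>(1) a(1) by argo
    then have "(\<lambda>n. 3 / 2 * (ln (real m * real n) * real n powr (\<Delta> + \<delta> - 1 / 2))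
        + exp 1 * (real n powr \<Delta> * exp (- (real n powr a))) + real n powr (- (\<rho> - \<Delta>) / 2)
        + 2 * (real n powr (a + \<Delta>) * exp (- (real n powr \<epsilon>)))) \<longlonglongrightarrow> 3 / 2 * 0 + exp 1 * 0 + 0 + 2 * 0"
      using \<Delta>(2)[folded \<rho>_def] a m \<epsilon>(1)
      by (intro tendsto_add tendsto_mult_left ln_powr_neg_tendsto_0 powr_exp_powr_tendsto_0 powr_neg_tendsto_0)
        auto
    moreover have "f n * real n powr \<Delta> = 3 / 2 * (ln (real m * real n) * real n powr (\<Delta> + \<delta> - 1 / 2))
        + exp 1 * (real n powr \<Delta> * exp (- (real n powr a))) + real n powr (- (\<rho> - \<Delta>) / 2)
        + 2 * (real n powr (a + \<Delta>) * exp (- (real n powr \<epsilon>)))" for n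
    proof -
      have "real n powr (\<delta> - 1 / 2) * real n powr \<Delta> = real n powr (\<Delta> + \<delta> - 1 / 2)"
        "real n powr (- (\<rho> + \<Delta>) / 2) * real n powr \<Delta> = real n powr (- (\<rho> - \<Delta>) / 2)"
        "real n powr a * real n powr \<Delta> = real n powr (a + \<Delta>)"
        unfolding powr_add[symmetric] by (rule arg_cong[where f = "\<lambda>t. real n powr t"]; simp add: field_simps)+
      note e = this
      show ?thesis unfolding f_def e[symmetric] by (simp add: algebra_simps)
    qed
    ultimately show ?thesis by simp
  qed
  have "\<forall>\<^sub>F n in sequentially.
    \<P>(\<omega> in attach_law m n. \<forall>j\<in>{1..nat \<lfloor>real n powr a\<rfloor>}.
      \<bar>real (attach_degree m n \<omega> j) - approx_degree m n \<omega> j\<bar>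
        \<le> (3 + 6 * real m + 2 * K) * real n powr (- \<delta>) * approx_degree m n \<omega> j)
    \<ge> 1 - real n powr (- \<Delta>)"
    using eventually_le_powr_minus[OF lim] eventually_ge_at_top[of 1]
  proof eventually_elim
    case (elim n)
    define J where "J = nat \<lfloor>real n powr a\<rfloor>"
    have n0: "0 < real n" using elim by simp
    have a1: "a \<le> 1" using a_less_1 by simp
    note J = nat_floor_powr_bounds[OF elim(2) a(1) a1, folded J_def]
    \<comment> \<open>The threshold \<open>?x\<close> is the relative error \<open>?\<tau>\<close>
      on the scale \<open>sqrt n\<close> of the inverse square root sum.\<close>
    let ?\<tau> = "real n powr (- \<delta>)" and ?c = "real n powr \<epsilon>" and ?x = "real n powr (1 / 2 - \<delta>)"
    have x: "?x = ?\<tau> * sqrt (real n)"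
      using n0 by (simp add: powr_half_sqrt[symmetric] powr_add[symmetric])
    have \<tau>1: "?\<tau> \<le> 1" using elim \<delta> powr_mono[of "- \<delta>" 0 "real n"] by simp
    have c1: "1 \<le> ?c" using elim \<epsilon> by (intro ge_one_powr_ge_zero) auto
    have "sqrt (real (m * J + 1)) \<le> sqrt (2 * real m * real J)"
    proof (rule real_sqrt_le_mono)
      have "1 * 1 \<le> m * J" using m J(1) by (rule mult_le_mono)
      then have "real 1 \<le> real (m * J)" by (simp only: of_nat_le_iff)
      then show "real (m * J + 1) \<le> 2 * real m * real J" by (simp add: algebra_simps)
    qed
    also have "\<dots> = sqrt (2 * real m) * sqrt (real J)" by (simp add: real_sqrt_mult)
    also have "\<dots> \<le> sqrt (2 * real m) * real n powr (a / 2)" using J(5) by (intro mult_left_mono) auto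
    also have "\<dots> \<le> sqrt (2 * real m) * ?x"
      using delta_less \<delta>(1) elim by (intro mult_left_mono powr_mono) auto
    finally have "?x + 2 * sqrt (real (m * J + 1)) \<le> K * ?x" by (simp add: K_def algebra_simps)
    then have K: "?x + 2 * sqrt (real (m * J + 1)) \<le> K * ?\<tau> * sqrt (real n)" by (simp add: x)
    have e1: "?c / ?\<tau>\<^sup>2 = real n powr (\<epsilon> + 2 * \<delta>)"
      using n0 by (simp add: powr_power powr_diff[symmetric])
    have e2: "a + real m * (\<epsilon> + 2 * \<delta> + a / 2 - 1 / 2) = - (\<rho> + \<Delta>) / 2"
      using \<epsilon>(2) unfolding \<rho> by (simp add: field_simps)
    have t3: "real J * (?c / ?\<tau>\<^sup>2 * sqrt (real J) / sqrt (real n)) ^ m \<le> real n powr (- (\<rho> + \<Delta>) / 2)"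
      using block_probability_powr_bound[OF elim(2) a(1) a1, of "\<epsilon> + 2 * \<delta>" m, folded J_def]
      unfolding e1 e2 .
    have t1: "3 / 2 * ln (real (m * n)) / ?x = 3 / 2 * (ln (real m * real n) * real n powr (\<delta> - 1 / 2))"
      using n0 by (simp add: powr_minus_divide[symmetric] divide_powr_uminus)
    have t2: "exp (- real (m * J)) \<le> exp 1 * exp (- (real n powr a))"
      unfolding J_def by (rule exp_floor_powr_bound[OF elim(2) a(1) a1 m])
    have t4: "2 * real J * exp (- ?c) \<le> 2 * (real n powr a * exp (- ?c))" using J(3) by simp
    have "\<P>(\<omega> in attach_law m n. \<forall>j\<in>{1..J}.
        \<bar>real (attach_degree m n \<omega> j) - approx_degree m n \<omega> j\<bar>
          \<le> (3 + 6 * real m + 2 * K) * ?\<tau> * approx_degree m n \<omega> j)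
      \<ge> 1 - (3 / 2 * ln (real (m * n)) / ?x + exp (- real (m * J))
        + real J * (?c / ?\<tau>\<^sup>2 * sqrt (real J) / sqrt (real n)) ^ m + 2 * real J * exp (- ?c))"
      by (rule prob_attach_law_degree_approx[OF m J(1,2) _ \<tau>1 c1 _ K]) (use n0 in auto)
    moreover have "3 / 2 * ln (real (m * n)) / ?x + exp (- real (m * J))
        + real J * (?c / ?\<tau>\<^sup>2 * sqrt (real J) / sqrt (real n)) ^ m + 2 * real J * exp (- ?c) \<le> f n"
      unfolding f_def using t1 t2 t3 t4 by linarith
    ultimately show ?case using elim(1) unfolding J_def by linarith
  qed
  then show ?thesis by blast
qed

text \<open>Where the approximation holds with relative error below \<open>1 / 2\<close>, every
  degree exceeds half its approximation or equals it, so it suffices that all approximations are at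
  least a little more than \<open>2 * n powr b\<close>. The two events are combined by a union
  bound.\<close>

lemma min_degree_eventually:
  assumes \<Delta>: "\<Delta> < (1 - a) / 2 - \<delta>"
    "\<Delta> < (real m / 2) * (1 - a * (real m + 2) / real m) - 2 * real m * \<delta>"
    and \<Delta>\<^sub>1: "\<Delta>\<^sub>1 < \<Delta>" "\<Delta>\<^sub>1 < real m * ((1 / 2) * (1 - a * (real m + 2) / real m) - b)"
  shows "\<forall>\<^sub>F n in sequentially.
    \<P>(\<omega> in attach_law m n.
      real (Min (attach_degree m n \<omega> ` {1..nat \<lfloor>real n powr a\<rfloor>})) > real n powr b)
    \<ge> 1 - real n powr (- \<Delta>\<^sub>1)"
proof -
  obtain C where C: "\<forall>\<^sub>F n in sequentially.
    \<P>(\<omega> in attach_law m n. \<forall>j\<in>{1..nat \<lfloor>real n powr a\<rfloor>}.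
      \<bar>real (attach_degree m n \<omega> j) - approx_degree m n \<omega> j\<bar>
        \<le> C * real n powr (- \<delta>) * approx_degree m n \<omega> j)
    \<ge> 1 - real n powr (- \<Delta>)"
    using degree_approx_eventually[OF \<Delta>] by blast
  define \<sigma> where "\<sigma> = real m * ((1 / 2) * (1 - a * (real m + 2) / real m) - b)"
  have \<sigma>: "\<sigma> = real m / 2 - a * (real m + 2) / 2 - real m * b"
    unfolding \<sigma>_def using m by (simp add: field_simps)
  \<comment> \<open>Again half of the slack is used, leaving the midpoint exponent
    \<open>(\<sigma> + \<Delta>\<^sub>1) / 2\<close> for the block term.\<close>
  define \<epsilon> where "\<epsilon> = (\<sigma> - \<Delta>\<^sub>1) / (2 * real m)"
  have \<epsilon>: "0 < \<epsilon>" "real m * \<epsilon> = (\<sigma> - \<Delta>\<^sub>1) / 2" using \<Delta>\<^sub>1(2) m by (auto simp: \<epsilon>_def \<sigma>_def)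
  define f where "f n = real n powr (- \<Delta>) + exp 1 * exp (- (real n powr a)) + real n powr (- (\<sigma> + \<Delta>\<^sub>1) / 2)"
    for n :: nat
  have lim: "(\<lambda>n. f n * real n powr \<Delta>\<^sub>1) \<longlonglongrightarrow> 0"
  proof -
    have "(\<lambda>n. real n powr (\<Delta>\<^sub>1 - \<Delta>) + exp 1 * (real n powr \<Delta>\<^sub>1 * exp (- (real n powr a)))
        + real n powr (- (\<sigma> - \<Delta>\<^sub>1) / 2)) \<longlonglongrightarrow> 0 + exp 1 * 0 + 0"
      using \<Delta>\<^sub>1(1) \<Delta>\<^sub>1(2)[folded \<sigma>_def] a
      by (intro tendsto_add tendsto_mult_left powr_exp_powr_tendsto_0 powr_neg_tendsto_0) auto
    moreover have "f n * real n powr \<Delta>\<^sub>1 = real n powr (\<Delta>\<^sub>1 - \<Delta>)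
        + exp 1 * (real n powr \<Delta>\<^sub>1 * exp (- (real n powr a))) + real n powr (- (\<sigma> - \<Delta>\<^sub>1) / 2)" for n
    proof -
      have "real n powr (- \<Delta>) * real n powr \<Delta>\<^sub>1 = real n powr (\<Delta>\<^sub>1 - \<Delta>)"
        "real n powr (- (\<sigma> + \<Delta>\<^sub>1) / 2) * real n powr \<Delta>\<^sub>1 = real n powr (- (\<sigma> - \<Delta>\<^sub>1) / 2)"
        unfolding powr_add[symmetric] by (rule arg_cong[where f = "\<lambda>t. real n powr t"]; simp add: field_simps)+
      note e = this
      show ?thesis unfolding f_def e[symmetric] by (simp add: algebra_simps)
    qed
    ultimately show ?thesis by simp
  qed
  have "(\<lambda>n. C * real n powr (- \<delta>)) \<longlonglongrightarrow> C * 0"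
    using \<delta> by (intro tendsto_mult_left powr_neg_tendsto_0) auto
  then have small: "\<forall>\<^sub>F n in sequentially. C * real n powr (- \<delta>) < 1 / 2"
    by (rule order_tendstoD) simp
  have "(\<lambda>n. real n powr (- \<epsilon>)) \<longlonglongrightarrow> 0" using \<epsilon> by (intro powr_neg_tendsto_0) auto
  then have big: "\<forall>\<^sub>F n in sequentially. real n powr (- \<epsilon>) < 1 / 4"
    by (rule order_tendstoD) simp
  show ?thesis
    using eventually_le_powr_minus[OF lim] eventually_ge_at_top[of 1] C small big
  proof eventually_elim
    case (elim n)
    define J where "J = nat \<lfloor>real n powr a\<rfloor>"
    have n0: "0 < real n" using elim by simp
    have a1: "a \<le> 1" using a_less_1 by simp
    note J = nat_floor_powr_bounds[OF elim(2) a(1) a1, folded J_def]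
    interpret P: prob_space "attach_law m n" by (rule prob_space_attach_law)
    \<comment> \<open>The factor \<open>1 / 2\<close> cancels the \<open>2\<close> in the block
      bound; \<open>n powr (- \<epsilon>) < 1 / 4\<close> then gives
      \<open>n powr b < L / 2\<close>.\<close>
    define L where "L = real n powr (b + \<epsilon>) / 2"
    let ?A1 = "{\<omega> \<in> space (attach_law m n). \<forall>j\<in>{1..J}.
      \<bar>real (attach_degree m n \<omega> j) - approx_degree m n \<omega> j\<bar> \<le> C * real n powr (- \<delta>) * approx_degree m n \<omega> j}"
    let ?A2 = "{\<omega> \<in> space (attach_law m n). \<forall>j\<in>{1..J}. L \<le> approx_degree m n \<omega> j}"
    let ?A3 = "{\<omega> \<in> space (attach_law m n). real (Min (attach_degree m n \<omega> ` {1..J})) > real n powr b}"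
    have A1: "?A1 \<in> sets (attach_law m n)"
      using J(2) by (rule degree_deviation_measurable)
    have A2: "?A2 \<in> sets (attach_law m n)"
      using J(2) by (intro sets.sets_Collect_finite_All borel_measurable_le borel_measurable_const
          approx_degree_measurable_attach) auto
    have A3_eq: "?A3 = {\<omega> \<in> space (attach_law m n). \<forall>j\<in>{1..J}. real n powr b < real (attach_degree m n \<omega> j)}"
    proof -
      have "real n powr b < real (Min (attach_degree m n \<omega> ` {1..J}))
          \<longleftrightarrow> (\<forall>j\<in>{1..J}. real n powr b < real (attach_degree m n \<omega> j))" for \<omega>
      proof
        assume less: "real n powr b < real (Min (attach_degree m n \<omega> ` {1..J}))"
        show "\<forall>j\<in>{1..J}. real n powr b < real (attach_degree m n \<omega> j)"
        proof
          fix j assume "j \<in> {1..J}"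
          then have "Min (attach_degree m n \<omega> ` {1..J}) \<le> attach_degree m n \<omega> j" by (intro Min_le) auto
          then show "real n powr b < real (attach_degree m n \<omega> j)" using less by linarith
        qed
      next
        assume "\<forall>j\<in>{1..J}. real n powr b < real (attach_degree m n \<omega> j)"
        \<comment> \<open>\<open>J \<ge> 1\<close> keeps the set nonempty, so \<open>Min\<close> is
          attained.\<close>
        moreover have "Min (attach_degree m n \<omega> ` {1..J}) \<in> attach_degree m n \<omega> ` {1..J}"
          using J(1) by (intro Min_in) auto
        ultimately show "real n powr b < real (Min (attach_degree m n \<omega> ` {1..J}))" by auto
      qed
      then show ?thesis by blast
    qed
    have A3: "?A3 \<in> sets (attach_law m n)"
      unfolding A3_eq
      by (intro sets.sets_Collect_finite_All borel_measurable_less borel_measurable_const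
          attach_degree_real_measurable) auto
    have L2: "real n powr b < L / 2"
    proof -
      have "real n powr b = real n powr (b + \<epsilon>) * real n powr (- \<epsilon>)" by (simp add: powr_add[symmetric])
      also have "\<dots> < real n powr (b + \<epsilon>) * (1 / 4)" using elim(5) n0 by (intro mult_strict_left_mono) auto
      finally show ?thesis by (simp add: L_def)
    qed
    have sub: "?A1 \<inter> ?A2 \<subseteq> ?A3"
    proof
      fix \<omega> assume \<omega>: "\<omega> \<in> ?A1 \<inter> ?A2"
      have "real n powr b < real (attach_degree m n \<omega> j)" if j: "j \<in> {1..J}" for j
      proof -
        let ?D = "approx_degree m n \<omega> j"
        have 1: "\<bar>real (attach_degree m n \<omega> j) - ?D\<bar> \<le> C * real n powr (- \<delta>) * ?D" "L \<le> ?D"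
          using \<omega> j by auto
        have "0 \<le> L" by (simp add: L_def)
        then have "C * real n powr (- \<delta>) * ?D \<le> 1 / 2 * ?D"
          using elim(4) 1(2) by (intro mult_right_mono) auto
        then show ?thesis using 1 L2 by linarith
      qed
      then show "\<omega> \<in> ?A3" unfolding A3_eq using \<omega> by blast
    qed
    have p1: "1 - real n powr (- \<Delta>) \<le> P.prob ?A1" using elim(3) unfolding J_def .
    have "1 - (exp (- real (m * J)) + real J * (2 * L * sqrt (real J) / sqrt (real n)) ^ m) \<le> P.prob ?A2"
      by (rule prob_attach_law_approx_degree_ge[OF m J(1,2)]) (simp add: L_def)
    moreover have "real J * (2 * L * sqrt (real J) / sqrt (real n)) ^ m \<le> real n powr (- (\<sigma> + \<Delta>\<^sub>1) / 2)"
    proof -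
      have e: "a + real m * (b + \<epsilon> + a / 2 - 1 / 2) = - (\<sigma> + \<Delta>\<^sub>1) / 2"
        using \<epsilon>(2) unfolding \<sigma> by (simp add: field_simps)
      show ?thesis
        using block_probability_powr_bound[OF elim(2) a(1) a1, of "b + \<epsilon>" m, folded J_def]
        unfolding e by (simp add: L_def)
    qed
    moreover have "exp (- real (m * J)) \<le> exp 1 * exp (- (real n powr a))"
      unfolding J_def by (rule exp_floor_powr_bound[OF elim(2) a(1) a1 m])
    moreover have "P.prob ?A1 + P.prob ?A2 - 1 \<le> P.prob ?A3"
      using A1 A2 A3 sub by (rule P.prob_ge_if_inter_subset)
    ultimately have "1 - f n \<le> P.prob ?A3" using p1 unfolding f_def by linarith
    then show ?case using elim(1) unfolding J_def by linarith
  qed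
qed

end

text \<open>With \<open>a = m / (m + 2) - \<epsilon>\<close> the quantity
  \<open>z = 1 - a * (m + 2) / m\<close> equals \<open>\<epsilon> * (m + 2) / m\<close>, so the
  target exponent is \<open>z / 2 - \<eta>\<close>. The margin \<open>\<eta>\<close> keeps it
  strictly below the critical \<open>z / 2\<close>, where the decay rate of the minimum-degree bound
  would vanish.\<close>

lemma degree_lower_bound_tendsto:
  fixes m :: nat and \<epsilon> \<eta> :: real
  assumes m: "1 \<le> m" and \<epsilon>: "0 < \<epsilon>" "\<epsilon> < real m / (real m + 2)" and \<eta>: "0 < \<eta>"
  shows "(\<lambda>n. \<P>(\<omega> in attach_law m n.
      \<forall>j\<in>{1..nat \<lfloor>real n powr (real m / (real m + 2) - \<epsilon>)\<rfloor>}.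
        real (attach_degree m n \<omega> j) \<ge> real n powr (\<epsilon> * (real m + 2) / (2 * real m) - \<eta>)))
    \<longlonglongrightarrow> 1"
proof -
  define a where "a = real m / (real m + 2) - \<epsilon>"
  define z where "z = 1 - a * (real m + 2) / real m"
  have m0: "0 < real m" using m by simp
  have z: "z = \<epsilon> * (real m + 2) / real m"
  proof -
    have "a * (real m + 2) = real m - \<epsilon> * (real m + 2)" by (simp add: a_def left_diff_distrib)
    then show ?thesis using m0 by (simp add: z_def diff_divide_distrib)
  qed
  have z0: "0 < z" unfolding z using \<epsilon> m0 by simp
  define b where "b = z / 2 - \<eta>"
  have b: "\<epsilon> * (real m + 2) / (2 * real m) - \<eta> = b" by (simp add: b_def z)
  \<comment> \<open>Any value below \<open>z / 4\<close> is admissible as \<open>\<delta>\<close>;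
    with \<open>z / 8\<close> both upper bounds on \<open>\<Delta>\<close> are positive, so positive
    rates \<open>\<Delta>\<close> and \<open>\<Delta>\<^sub>1\<close> can be chosen.\<close>
  interpret X: preferential_attachment_exponents m a "z / 8"
    by unfold_locales (use m \<epsilon> z0 in \<open>auto simp: a_def z_def[unfolded a_def, symmetric]\<close>)
  have "0 < (1 - a) / 2 - z / 8" using X.delta_less X.a_less_1 by simp
  moreover have "0 < (real m / 2) * z - 2 * real m * (z / 8)" using z0 m0 by simp
  ultimately obtain \<Delta> where
    \<Delta>: "0 < \<Delta>" "\<Delta> < (1 - a) / 2 - z / 8" "\<Delta> < (real m / 2) * z - 2 * real m * (z / 8)"
    using field_lbound_gt_zero by blast
  obtain \<Delta>\<^sub>1 where \<Delta>\<^sub>1: "0 < \<Delta>\<^sub>1" "\<Delta>\<^sub>1 < \<Delta>" "\<Delta>\<^sub>1 < real m * \<eta>"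
    using field_lbound_gt_zero[OF \<Delta>(1) mult_pos_pos[OF m0 \<eta>]] by blast
  \<comment> \<open>For this \<open>b\<close>, the second upper bound on
    \<open>\<Delta>\<^sub>1\<close> is exactly \<open>m * \<eta>\<close>.\<close>
  have "real m * \<eta> = real m * (1 / 2 * z - b)" by (simp add: b_def)
  then have ev: "\<forall>\<^sub>F n in sequentially. 1 - real n powr (- \<Delta>\<^sub>1)
      \<le> \<P>(\<omega> in attach_law m n. real (Min (attach_degree m n \<omega> ` {1..nat \<lfloor>real n powr a\<rfloor>})) > real n powr b)"
    using \<Delta> \<Delta>\<^sub>1 by (intro X.min_degree_eventually) (auto simp: z_def)
  let ?p = "\<lambda>n. \<P>(\<omega> in attach_law m n. \<forall>j\<in>{1..nat \<lfloor>real n powr a\<rfloor>}. real (attach_degree m n \<omega> j) \<ge> real n powr b)"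
  have lower: "\<forall>\<^sub>F n in sequentially. 1 - real n powr (- \<Delta>\<^sub>1) \<le> ?p n"
    using ev
  proof eventually_elim
    case (elim n)
    interpret P: prob_space "attach_law m n" by (rule prob_space_attach_law)
    have "\<P>(\<omega> in attach_law m n. real (Min (attach_degree m n \<omega> ` {1..nat \<lfloor>real n powr a\<rfloor>})) > real n powr b) \<le> ?p n"
    proof (rule P.finite_measure_mono)
      show "{\<omega> \<in> space (attach_law m n). real (Min (attach_degree m n \<omega> ` {1..nat \<lfloor>real n powr a\<rfloor>})) > real n powr b}
        \<subseteq> {\<omega> \<in> space (attach_law m n). \<forall>j\<in>{1..nat \<lfloor>real n powr a\<rfloor>}. real (attach_degree m n \<omega> j) \<ge> real n powr b}"
      proof (intro Collect_mono impI conjI ballI; elim conjE)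
        fix \<omega> j assume j: "j \<in> {1..nat \<lfloor>real n powr a\<rfloor>}"
          and less: "real n powr b < real (Min (attach_degree m n \<omega> ` {1..nat \<lfloor>real n powr a\<rfloor>}))"
        have "Min (attach_degree m n \<omega> ` {1..nat \<lfloor>real n powr a\<rfloor>}) \<le> attach_degree m n \<omega> j"
          using j by (intro Min_le) auto
        then show "real n powr b \<le> real (attach_degree m n \<omega> j)" using less by linarith
      qed
      show "{\<omega> \<in> space (attach_law m n). \<forall>j\<in>{1..nat \<lfloor>real n powr a\<rfloor>}. real (attach_degree m n \<omega> j) \<ge> real n powr b}
        \<in> sets (attach_law m n)"
        by (intro sets.sets_Collect_finite_All borel_measurable_le borel_measurable_const
            attach_degree_real_measurable) auto
    qed
    with elim show ?case by linarith
  qed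
  have upper: "\<forall>\<^sub>F n in sequentially. ?p n \<le> 1"
    by (intro always_eventually allI prob_space.prob_le_1 prob_space_attach_law)
  have "(\<lambda>n. 1 - real n powr (- \<Delta>\<^sub>1)) \<longlonglongrightarrow> 1 - 0"
    using \<Delta>\<^sub>1 by (intro tendsto_diff tendsto_const powr_neg_tendsto_0) auto
  then have "?p \<longlonglongrightarrow> 1"
    using lower upper by (intro tendsto_sandwich[OF lower upper]) auto
  then show ?thesis unfolding a_def[symmetric] b .
qed

theorem theorem2p1:
  fixes m :: nat and a \<delta> b :: real
  assumes "m \<ge> 1"
    and "0 < a" and "a < real m / (real m + 2)"
    and "0 < \<delta>" and "\<delta> < (1 / 4) * (1 - a * (real m + 2) / real m)"
    and "0 < b" and "b < (1 / 2) * (1 - a * (real m + 2) / real m)"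
  shows
    "(\<forall>\<Delta>::real.
        \<Delta> < min ((1 - a) / 2 - \<delta>)
                ((real m / 2) * (1 - a * (real m + 2) / real m) - 2 * real m * \<delta>) \<longrightarrow>
        (\<exists>C::real. \<forall>\<^sub>F n in sequentially.
           \<P>(\<omega> in attach_law m n.
               \<forall>j\<in>{1..nat \<lfloor>real n powr a\<rfloor>}.
                 \<bar>real (attach_degree m n \<omega> j) - approx_degree m n \<omega> j\<bar>
                   \<le> C * real n powr (- \<delta>) * approx_degree m n \<omega> j)
             \<ge> 1 - real n powr (- \<Delta>)))
   \<and> (\<forall>\<Delta> \<Delta>\<^sub>1 :: real.
        \<Delta> < min ((1 - a) / 2 - \<delta>)
                ((real m / 2) * (1 - a * (real m + 2) / real m) - 2 * real m * \<delta>) \<longrightarrow>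
        \<Delta>\<^sub>1 < min \<Delta> (real m * ((1 / 2) * (1 - a * (real m + 2) / real m) - b)) \<longrightarrow>
        (\<forall>\<^sub>F n in sequentially.
           \<P>(\<omega> in attach_law m n.
               real (Min (attach_degree m n \<omega> ` {1..nat \<lfloor>real n powr a\<rfloor>})) > real n powr b)
             \<ge> 1 - real n powr (- \<Delta>\<^sub>1)))
   \<and> (\<forall>\<epsilon> \<eta> :: real.
        0 < \<epsilon> \<longrightarrow> \<epsilon> < real m / (real m + 2) \<longrightarrow> 0 < \<eta> \<longrightarrow>
        (\<lambda>n. \<P>(\<omega> in attach_law m n.
               \<forall>j\<in>{1..nat \<lfloor>real n powr (real m / (real m + 2) - \<epsilon>)\<rfloor>}.
                 real (attach_degree m n \<omega> j) \<ge> real n powr (\<epsilon> * (real m + 2) / (2 * real m) - \<eta>)))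
          \<longlonglongrightarrow> 1)"
proof -
  interpret preferential_attachment_exponents m a \<delta>
    by unfold_locales (use assms in auto)
  show ?thesis
    using degree_approx_eventually min_degree_eventually degree_lower_bound_tendsto[OF assms(1)]
    by (simp only: min_less_iff_conj) blast
qed

end
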